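(* Let $K,\ell\in\mathbb N$ with $\ell$ even, and let $\mathsf R$ be a degenerate $(K,\ell)$-rule. Then $\mathbb E[T_{\mathrm{con}}^{\mathsf R}]=\Omega(n^2)$ as $n\to\infty$.
   Context: $\mathbb N=\{1,2,3,\dots\}$, $\mathbb N_0=\{0,1,2,\dots\}$, $[m]=\{1,\dots,m\}$. Let $K,\ell\in\mathbb N$ with $\ell$ even, and $S_K=\{1,2,\dots,K,\omega\}$, where $\omega$ is a formal symbol standing for "larger than $K$". A $(K,\ell)$-rule is a map $\mathsf R:S_K^\ell\to[\ell/2]$. For a graph $G$ and a vertex $v$, let $c_K(G;v)$ be the number of vertices of the component of $G$ containing $v$ if this number is at most $K$, and $c_K(G;v)=\omega$ otherwise. The $\mathsf R$-process with $n$ vertices is the random graph sequence $(G_N^{\mathsf R})_{N\ge0}$: $G_0^{\mathsf R}$ has vertex set $[n]$ and no edges; in round $N\ge1$, $\ell$ vertices $v_1,\dots,v_\ell$ are chosen independently and uniformly at random from $[n]$ (repetitions allowed), and $G_N^{\mathsf R}$ is obtained from $G_{N-1}^{\mathsf R}$ by adding the edge $\{v_{2i-1},v_{2i}\}$, where $i=\mathsf R(c_K(G_{N-1}^{\mathsf R};v_1),\dots,c_K(G_{N-1}^{\mathsf R};v_\ell))$; loops and multiple edges are ignored. $T_{\mathrm{con}}^{\mathsf R}=T_{\mathrm{con}}^{\mathsf R}(n)$ is the smallest $N\in\mathbb N_0\cup\{\infty\}$ such that $G_N^{\mathsf R}$ is connected. For $\mu,\nu\in S_K$ let $$C_{\mu,\nu}(\mathsf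 R)=\{s=(s_1,\dots,s_\ell)\in S_K^\ell\mid \{s_{2i-1},s_{2i}\}=\{\mu,\nu\},\text{ where } i=\mathsf R(s)\}.$$ For $1\le k\le K$ let $$\mathrm{ex}_k(\mathsf R)=k\cdot\left|\{s\in C_{k,\omega}(\mathsf R)\mid \exists i\in[\ell]:\ s_i=k\text{ and }s_j=\omega\text{ for all }j\in[\ell]\setminus\{i\}\}\right|,$$ and $\mathrm{ex}(\mathsf R)=\min_{1\le k\le K}\mathrm{ex}_k(\mathsf R)$. The rule is degenerate if $\mathrm{ex}(\mathsf R)=0$. *)

theory Defs
  imports "HOL-Probability.Probability"
begin

text \<open>A graph is given by its vertex set \<open>V\<close> and its set \<open>E\<close> of two-element edges.\<close>

definition adj :: "'a set set \<Rightarrow> 'a rel" where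
  "adj E = {(x, y). {x, y} \<in> E}"

definition component :: "'a set \<Rightarrow> 'a set set \<Rightarrow> 'a \<Rightarrow> 'a set" where
  "component V E v = {w \<in> V. (v, w) \<in> (adj E)\<^sup>*}"

definition connected_graph :: "'a set \<Rightarrow> 'a set set \<Rightarrow> bool" where
  "connected_graph V E \<longleftrightarrow> V \<noteq> {} \<and> (\<forall>v\<in>V. \<forall>w\<in>V. (v, w) \<in> (adj E)\<^sup>*)"

definition add_edge :: "'a \<Rightarrow> 'a \<Rightarrow> 'a set set \<Rightarrow> 'a set set" where
  "add_edge u w E = (if u = w then E else insert {u, w} E)"

text \<open>\<open>Omega\<close> stands for \<open>larger than K\<close>.\<close>

datatype csize = Size nat | Omega

definition S :: "nat \<Rightarrow> csize set" where
  "S K = Size ` {1..K} \<union> {Omega}"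

text \<open>Tuples of length \<open>l\<close> are extensional functions on \<open>{1..l}\<close>.\<close>

definition S_tuples :: "nat \<Rightarrow> nat \<Rightarrow> (nat \<Rightarrow> csize) set" where
  "S_tuples K l = {1..l} \<rightarrow>\<^sub>E S K"

definition is_rule :: "nat \<Rightarrow> nat \<Rightarrow> ((nat \<Rightarrow> csize) \<Rightarrow> nat) \<Rightarrow> bool" where
  "is_rule K l R \<longleftrightarrow> R \<in> S_tuples K l \<rightarrow> {1..l div 2}"

definition comp_size :: "nat \<Rightarrow> 'a set \<Rightarrow> 'a set set \<Rightarrow> 'a \<Rightarrow> csize" where
  "comp_size K V E v =
     (if card (component V E v) \<le> K then Size (card (component V E v)) else Omega)"

definition step ::
  "nat \<Rightarrow> nat \<Rightarrow> ((nat \<Rightarrow> csize) \<Rightarrow> nat) \<Rightarrow> 'a set \<Rightarrow> 'a set set \<Rightarrow> (nat \<Rightarrow> 'a) \<Rightarrow> 'a set set" where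
  "step K l R V E v =
     (let i = R (\<lambda>j\<in>{1..l}. comp_size K V E (v j)) in add_edge (v (2*i - 1)) (v (2*i)) E)"

text \<open>The outcome \<open>v\<close> records the vertices \<open>v N 1, \<dots>, v N l\<close> chosen in round \<open>N + 1\<close>.\<close>

definition process_space :: "nat \<Rightarrow> nat \<Rightarrow> (nat \<Rightarrow> nat \<Rightarrow> nat) measure" where
  "process_space l n =
     (\<Pi>\<^sub>M N\<in>UNIV. \<Pi>\<^sub>M j\<in>{1..l}. uniform_count_measure {1..n})"

primrec G ::
  "nat \<Rightarrow> nat \<Rightarrow> ((nat \<Rightarrow> csize) \<Rightarrow> nat) \<Rightarrow> nat \<Rightarrow> (nat \<Rightarrow> nat \<Rightarrow> nat) \<Rightarrow> nat \<Rightarrow> nat set set" where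
  "G K l R n v 0 = {}"
| "G K l R n v (Suc N) = step K l R {1..n} (G K l R n v N) (v N)"

definition T_con ::
  "nat \<Rightarrow> nat \<Rightarrow> ((nat \<Rightarrow> csize) \<Rightarrow> nat) \<Rightarrow> nat \<Rightarrow> (nat \<Rightarrow> nat \<Rightarrow> nat) \<Rightarrow> enat" where
  "T_con K l R n v = Inf {enat N | N. connected_graph {1..n} (G K l R n v N)}"

definition expected_T_con ::
  "nat \<Rightarrow> nat \<Rightarrow> ((nat \<Rightarrow> csize) \<Rightarrow> nat) \<Rightarrow> nat \<Rightarrow> ennreal" where
  "expected_T_con K l R n =
     (\<integral>\<^sup>+ v. ennreal_of_enat (T_con K l R n v) \<partial>process_space l n)"

definition C ::
  "nat \<Rightarrow> nat \<Rightarrow> ((nat \<Rightarrow> csize) \<Rightarrow> nat) \<Rightarrow> csize \<Rightarrow> csize \<Rightarrow> (nat \<Rightarrow> csize) set" where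
  "C K l R \<mu> \<nu> = {s \<in> S_tuples K l. {s (2 * R s - 1), s (2 * R s)} = {\<mu>, \<nu>}}"

definition ex_k :: "nat \<Rightarrow> nat \<Rightarrow> ((nat \<Rightarrow> csize) \<Rightarrow> nat) \<Rightarrow> nat \<Rightarrow> nat" where
  "ex_k K l R k =
     k * card {s \<in> C K l R (Size k) Omega.
                \<exists>i\<in>{1..l}. s i = Size k \<and> (\<forall>j\<in>{1..l} - {i}. s j = Omega)}"

definition ex :: "nat \<Rightarrow> nat \<Rightarrow> ((nat \<Rightarrow> csize) \<Rightarrow> nat) \<Rightarrow> nat" where
  "ex K l R = Min (ex_k K l R ` {1..K})"

definition degenerate :: "nat \<Rightarrow> nat \<Rightarrow> ((nat \<Rightarrow> csize) \<Rightarrow> nat) \<Rightarrow> bool" where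
  "degenerate K l R \<longleftrightarrow> ex K l R = 0"

text \<open>The Landau symbols of the library are for functions into normed fields; the expectation is an
  extended nonnegative real and may be infinite.\<close>

definition ennreal_bigomega :: "(nat \<Rightarrow> ennreal) \<Rightarrow> (nat \<Rightarrow> real) \<Rightarrow> bool" where
  "ennreal_bigomega f g \<longleftrightarrow> (\<exists>c>0. \<forall>\<^sub>F n in sequentially. ennreal (c * \<bar>g n\<bar>) \<le> f n)"

end

theory Submission imports Defs
begin

text \<open>
  Call a vertex small if its component has at most \<open>K\<close> vertices, and a size \<open>k \<le> K\<close> degenerate if
  \<open>ex_k K l R k = 0\<close>. For a degenerate size, a tuple with one vertex in a component of size \<open>k\<close> and all
  others large never touches that component. So a vertex in a component of degenerate size can only be
  lost in a round whose tuple contains a second small vertex. If only boundedly many small vertices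
  are left, such a round has probability \<open>O(1/n\<^sup>2)\<close>, and the graph stays disconnected for about \<open>n\<^sup>2\<close>
  rounds. The difficulty is to rule out that the degenerate components are used up earlier, together
  with the other small components.

  This is done with one potential. Let \<open>d\<close> be the number of vertices in components of degenerate
  size, \<open>a\<close> the number of the other small vertices and \<open>Z\<close> the number of components, and put
  \<open>\<Phi> = d / (d + 1) * exp (- w * Z / n)\<close> with a constant \<open>w\<close>. A round loses degenerate vertices with
  probability \<open>O(d * (d + a) / n\<^sup>2)\<close>, and then \<open>d / (d + 1)\<close> drops by \<open>O(1 / (d + 1)\<^sup>2)\<close>. The
  expected loss is therefore \<open>O(1/n\<^sup>2)\<close> plus \<open>O(a / n\<^sup>2)\<close> times \<open>d / (d + 1)\<close>. The second part is
  compensated by the exponential factor: two components merge with probability at least a constant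
  times \<open>a / n\<close> (\<open>card_merging\<close>), because either at least half of the vertices are small, or few are
  and a nondegenerate small vertex is often the only small one in its tuple. Hence the mean of
  \<open>\<Phi>\<close> decreases by at most \<open>O(1/n\<^sup>2)\<close> per round, whatever the current graph is (\<open>potential_drift\<close>).

  At the start \<open>\<Phi>\<close> may vanish, since there need not be components of degenerate size. But after
  \<open>n/4\<close> rounds the expected number of vertices in components of any fixed size \<open>k \<le> K\<close> is of order \<open>n\<close>
  (\<open>linear_growth\<close>, by induction on \<open>k\<close>): if every pair of the tuple consists of an isolated vertex and
  a vertex in a component of size \<open>k - 1\<close>, then any choice of the rule creates a component of size \<open>k\<close>.
  Since \<open>d / (d + 1) \<ge> d / (2 * n)\<close>, the mean of \<open>\<Phi>\<close> is then bounded below by a constant, and it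
  stays so for another constant times \<open>n\<^sup>2\<close> rounds. As \<open>\<Phi> \<le> 1\<close> and \<open>\<Phi> = 0\<close> for connected graphs, the
  graph is still disconnected at that time with probability bounded below.
\<close>

section \<open>Components under the addition of an edge\<close>

lemma sym_adj_rtrancl: "sym ((adj E)\<^sup>*)"
  by (rule sym_rtrancl) (auto simp: sym_def adj_def insert_commute)

lemma component_self: "v \<in> V \<Longrightarrow> v \<in> component V E v"
  by (simp add: component_def)

lemma component_subset: "component V E v \<subseteq> V"
  by (auto simp: component_def)

lemma component_eqI: "w \<in> component V E v \<Longrightarrow> component V E w = component V E v"
  using sym_adj_rtrancl[of E] unfolding component_def sym_def by (blast intro: rtrancl_trans)

text \<open>Two applications of \<open>rtrancl_insert\<close> to the right-hand side describe reachability after the addition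
  of an edge. The closures, unlike the relations, agree also for a loop.\<close>

lemma adj_add_edge: "(adj (add_edge u w E))\<^sup>* = (insert (u, w) (insert (w, u) (adj E)))\<^sup>*"
proof (cases "u = w")
  case True
  then show ?thesis by (auto simp: add_edge_def rtrancl_insert)
next
  case False
  then have "adj (add_edge u w E) = insert (u, w) (insert (w, u) (adj E))"
    by (auto simp: add_edge_def adj_def doubleton_eq_iff)
  then show ?thesis by simp
qed

text \<open>Reachability is an equivalence relation on \<open>V\<close> even if \<open>E\<close> has edges
  outside \<open>V\<close>. This lets the averaging operator act on functions of all sets \<open>E\<close>.\<close>

lemma component_add_edge:
  assumes "u \<in> V" "w \<in> V" "v \<in> V"
  shows "component V (add_edge u w E) v =
    (if v \<in> component V E u \<union> component V E w then component V E u \<union> component V E w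
     else component V E v)"
proof -
  have s: "\<And>x y. (x, y) \<in> (adj E)\<^sup>* \<longleftrightarrow> (y, x) \<in> (adj E)\<^sup>*"
    using sym_adj_rtrancl[of E] by (auto simp: sym_def)
  have t: "\<And>x y z. (x, y) \<in> (adj E)\<^sup>* \<Longrightarrow> (y, z) \<in> (adj E)\<^sup>* \<Longrightarrow> (x, z) \<in> (adj E)\<^sup>*"
    by (rule rtrancl_trans)
  show ?thesis
    using assms unfolding component_def adj_add_edge rtrancl_insert
    by (auto split: if_splits; (use s t in blast)?)
qed

lemma connected_add_edge:
  assumes "connected_graph V E"
  shows "connected_graph V (add_edge u w E)"
  using assms unfolding connected_graph_def adj_add_edge rtrancl_insert by blast

lemma component_connected:
  assumes "connected_graph V E" "v \<in> V"
  shows "component V E v = V"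
  using assms by (auto simp: connected_graph_def component_def)

definition vertices_in :: "'a set \<Rightarrow> nat set \<Rightarrow> 'a set set \<Rightarrow> 'a set" where
  "vertices_in V J E = {v \<in> V. card (component V E v) \<in> J}"

definition graph_components :: "'a set \<Rightarrow> 'a set set \<Rightarrow> 'a set set" where
  "graph_components V E = component V E ` V"

lemma vertices_in_subset: "vertices_in V J E \<subseteq> V"
  by (auto simp: vertices_in_def)

text \<open>A vertex whose component changes lies in one of the two joined components, and all vertices of that
  component have the same component size.\<close>

lemma vertices_in_lost:
  assumes "u \<in> V" "w \<in> V"
  shows "vertices_in V J E - vertices_in V J (add_edge u w E)
    \<subseteq> (if u \<in> vertices_in V J E then component V E u else {}) \<union>
      (if w \<in> vertices_in V J E then component V E w else {})"
proof
  fix v assume v: "v \<in> vertices_in V J E - vertices_in V J (add_edge u w E)"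
  then have vV: "v \<in> V" by (simp add: vertices_in_def)
  from v have "component V (add_edge u w E) v \<noteq> component V E v"
    by (auto simp: vertices_in_def)
  then have "v \<in> component V E u \<or> v \<in> component V E w"
    using component_add_edge[OF assms vV] by (auto split: if_splits)
  then show "v \<in> (if u \<in> vertices_in V J E then component V E u else {}) \<union>
      (if w \<in> vertices_in V J E then component V E w else {})"
  proof
    assume "v \<in> component V E u"
    then show ?thesis using component_eqI[of v V E u] v assms by (auto simp: vertices_in_def)
  next
    assume "v \<in> component V E w"
    then show ?thesis using component_eqI[of v V E w] v assms by (auto simp: vertices_in_def)
  qed
qed

text \<open>Only the component of an end of the edge can be lost, and only if its size is in \<open>J\<close>, so at most \<open>k\<close>
  vertices are lost at either end.\<close>

lemma card_vertices_in_lost: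
  assumes "finite V" "u \<in> V" "w \<in> V" "J \<subseteq> {..k}"
  shows "card (vertices_in V J E) \<le> card (vertices_in V J (add_edge u w E)) + 2 * k"
proof -
  let ?A = "if u \<in> vertices_in V J E then component V E u else {}"
  let ?B = "if w \<in> vertices_in V J E then component V E w else {}"
  have fin: "finite ?A" "finite ?B" "\<And>F. finite (vertices_in V J F)"
    using assms(1) finite_subset[OF component_subset] finite_subset[OF vertices_in_subset] by auto
  have "card (vertices_in V J E)
      \<le> card (vertices_in V J (add_edge u w E) \<union> (vertices_in V J E - vertices_in V J (add_edge u w E)))"
    using fin by (intro card_mono) auto
  also have "\<dots> \<le> card (vertices_in V J (add_edge u w E))
      + card (vertices_in V J E - vertices_in V J (add_edge u w E))"
    by (rule card_Un_le)
  also have "card (vertices_in V J E - vertices_in V J (add_edge u w E)) \<le> card (?A \<union> ?B)"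
    using fin by (intro card_mono vertices_in_lost assms) auto
  also have "\<dots> \<le> card ?A + card ?B" by (rule card_Un_le)
  also have "card ?A \<le> k" using assms(4) by (auto simp: vertices_in_def)
  also have "card ?B \<le> k" using assms(4) by (auto simp: vertices_in_def)
  finally show ?thesis by simp
qed

lemma vertices_in_mono:
  assumes "u \<in> V" "w \<in> V"
    and "component V E u = component V E w \<or> u \<notin> vertices_in V J E \<and> w \<notin> vertices_in V J E"
  shows "vertices_in V J E \<subseteq> vertices_in V J (add_edge u w E)"
proof (cases "component V E u = component V E w")
  case True
  have "component V (add_edge u w E) v = component V E v" if "v \<in> V" for v
    using component_add_edge[OF assms(1,2) that, of E] component_eqI[of v V E w] True by auto
  then show ?thesis by (auto simp: vertices_in_def)
next
  case False
  then show ?thesis using vertices_in_lost[OF assms(1,2), of J E] assms(3) by auto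
qed

lemma graph_components_add_edge:
  assumes "u \<in> V" "w \<in> V"
  shows "graph_components V (add_edge u w E) =
    insert (component V E u \<union> component V E w) (graph_components V E - {component V E u, component V E w})"
    (is "?L = ?R")
proof -
  have 1: "component V E v \<noteq> component V E x" if "v \<in> V" "v \<notin> component V E x" for v x
    using that component_self by metis
  show ?thesis
  proof
    show "?L \<subseteq> ?R"
      using 1 component_add_edge[OF assms] by (fastforce simp: graph_components_def split: if_splits)
    show "?R \<subseteq> ?L"
    proof
      fix X assume "X \<in> ?R"
      then consider "X = component V E u \<union> component V E w"
        | v where "v \<in> V" "X = component V E v" "X \<noteq> component V E u" "X \<noteq> component V E w"
        by (auto simp: graph_components_def)
      then show "X \<in> ?L"
      proof cases
        case 1
        then have "X = component V (add_edge u w E) u"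
          using component_add_edge[OF assms assms(1), of E] component_self[OF assms(1)] by auto
        then show ?thesis using assms by (auto simp: graph_components_def)
      next
        case 2
        then have "v \<notin> component V E u \<union> component V E w"
          using component_eqI[of v V E] by auto
        then have "X = component V (add_edge u w E) v"
          using component_add_edge[OF assms 2(1), of E] 2 by auto
        then show ?thesis using 2 by (auto simp: graph_components_def)
      qed
    qed
  qed
qed

lemma card_graph_components_add_edge:
  assumes "finite V" "u \<in> V" "w \<in> V"
  shows "card (graph_components V (add_edge u w E)) +
      (if component V E u \<noteq> component V E w then 1 else 0) \<le> card (graph_components V E)"
proof -
  let ?u = "component V E u" and ?w = "component V E w"
  have fin: "finite (graph_components V E)" using assms by (simp add: graph_components_def)
  have mem: "{?u, ?w} \<subseteq> graph_components V E" using assms by (auto simp: graph_components_def)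
  then have "card {?u, ?w} \<le> card (graph_components V E)" using fin by (intro card_mono)
  moreover have "card (graph_components V E - {?u, ?w}) = card (graph_components V E) - card {?u, ?w}"
    using mem fin by (intro card_Diff_subset) auto
  moreover have "card (graph_components V (add_edge u w E)) \<le> Suc (card (graph_components V E - {?u, ?w}))"
    unfolding graph_components_add_edge[OF assms(2,3)] by (rule card_insert_le_m1) simp_all
  ultimately show ?thesis by (cases "?u = ?w") auto
qed

section \<open>The process as an iteration of an averaging operator\<close>

locale rule_process =
  fixes K l :: nat and R :: "(nat \<Rightarrow> csize) \<Rightarrow> nat" and n :: nat
  assumes l_ge_1: "1 \<le> l" and even_l: "even l"
    and is_rule: "is_rule K l R" and n_ge_1: "1 \<le> n"
begin

definition tuples :: "(nat \<Rightarrow> nat) set" where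
  "tuples = {1..l} \<rightarrow>\<^sub>E {1..n}"

abbreviation next_graph :: "nat set set \<Rightarrow> (nat \<Rightarrow> nat) \<Rightarrow> nat set set" where
  "next_graph \<equiv> step K l R {1..n}"

text \<open>The transition operator of the Markov chain: the mean of \<open>f\<close> after one round that starts in \<open>E\<close>. Its
  \<open>N\<close>-th power is the mean after \<open>N\<close> rounds, so that all probabilistic estimates reduce to finite
  averages and pointwise inequalities.\<close>

definition round_mean :: "(nat set set \<Rightarrow> real) \<Rightarrow> nat set set \<Rightarrow> real" where
  "round_mean f E = (\<Sum>v\<in>tuples. f (next_graph E v)) / real n ^ l"

lemma finite_tuples: "finite tuples"
  unfolding tuples_def by (intro finite_PiE) auto

lemma card_tuples: "card tuples = n ^ l"
  unfolding tuples_def by (subst card_PiE) auto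

lemma tuples_nonempty: "tuples \<noteq> {}"
  using n_ge_1 card_tuples by (metis card.empty power_eq_0_iff not_one_le_zero)

lemma round_mean_nonneg: "(\<And>E. 0 \<le> f E) \<Longrightarrow> 0 \<le> round_mean f E"
  unfolding round_mean_def by (intro divide_nonneg_nonneg sum_nonneg) auto

lemma round_measure:
  "(\<Pi>\<^sub>M j\<in>{1..l}. uniform_count_measure {1..n}) = uniform_count_measure tuples"
proof (rule measure_eqI_finite)
  let ?M = "\<lambda>j::nat. uniform_count_measure {1..n}"
  interpret product_prob_space ?M "{1..l}"
    by (intro product_prob_spaceI prob_space_uniform_count_measure) (use n_ge_1 in auto)
  have "sets (\<Pi>\<^sub>M j\<in>{1..l}. uniform_count_measure {1..n})
      = sets (\<Pi>\<^sub>M j\<in>{1..l}. count_space {1..n})"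
    by (intro sets_PiM_cong) (auto simp: sets_uniform_count_measure)
  also have "\<dots> = Pow tuples"
    unfolding tuples_def by (subst count_space_PiM_finite) auto
  finally show "sets (\<Pi>\<^sub>M j\<in>{1..l}. uniform_count_measure {1..n}) = Pow tuples" .
  show "sets (uniform_count_measure tuples) = Pow tuples"
    by (simp add: sets_uniform_count_measure)
  show "finite tuples" by (rule finite_tuples)
  fix v assume v: "v \<in> tuples"
  have e: "{v} = (\<Pi>\<^sub>E j\<in>{1..l}. {v j})"
    using v by (subst PiE_singleton) (auto simp: tuples_def PiE_iff)
  have "emeasure (PiM {1..l} ?M) {v} = (\<Prod>j\<in>{1..l}. emeasure (?M j) {v j})"
    unfolding e using v
    by (intro emeasure_PiM) (auto simp: tuples_def PiE_iff sets_uniform_count_measure)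
  also have "\<dots> = (\<Prod>j\<in>{1..l}. ennreal (1 / real n))"
    using v by (intro prod.cong refl) (auto simp: tuples_def PiE_iff emeasure_uniform_count_measure)
  also have "\<dots> = ennreal (1 / real (n ^ l))"
    by (simp add: ennreal_power power_divide)
  also have "\<dots> = emeasure (uniform_count_measure tuples) {v}"
    using v finite_tuples by (subst emeasure_uniform_count_measure) (auto simp: card_tuples)
  finally show "emeasure (PiM {1..l} ?M) {v} = emeasure (uniform_count_measure tuples) {v}" .
qed

text \<open>Splitting off the first round instead of the last one fits the decomposition of the infinite product
  measure into its first factor and the rest (\<open>PiM_iter\<close>).\<close>

primrec run :: "nat \<Rightarrow> nat set set \<Rightarrow> (nat \<Rightarrow> nat \<Rightarrow> nat) \<Rightarrow> nat set set" where
  "run 0 E v = E"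
| "run (Suc N) E v = run N (next_graph E (v 0)) (\<lambda>i. v (Suc i))"

lemma run_Suc_last: "run (Suc N) E v = next_graph (run N E v) (v N)"
proof (induction N arbitrary: E v)
  case 0
  show ?case by simp
next
  case (Suc N)
  show ?case using Suc[of "next_graph E (v 0)" "\<lambda>i. v (Suc i)"] by simp
qed

lemma G_eq_run: "G K l R n v N = run N {} v"
  by (induction N) (simp_all add: run_Suc_last del: run.simps(2))

sublocale rounds: sequence_space "uniform_count_measure tuples"
  unfolding sequence_space_def
  by (intro product_prob_spaceI prob_space_uniform_count_measure finite_tuples tuples_nonempty)

lemma process_space_eq: "process_space l n = rounds.S"
  unfolding process_space_def by (simp only: round_measure)

text \<open>Sets of edges form an uncountable type with the discrete \<open>\<sigma>\<close>-algebra; measurability holds because the first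
  round has only finitely many outcomes and the rest follows by induction.\<close>

lemma measurable_run: "run N E \<in> rounds.S \<rightarrow>\<^sub>M count_space UNIV"
proof (induction N arbitrary: E)
  case 0
  show ?case by simp
next
  case (Suc N)
  have shift: "(\<lambda>v i. v (Suc i)) \<in> rounds.S \<rightarrow>\<^sub>M rounds.S"
    by (rule measurable_PiM_single') (auto simp: space_PiM)
  have "(\<lambda>v. run N (next_graph E (v 0)) (\<lambda>i. v (Suc i))) \<in> rounds.S \<rightarrow>\<^sub>M count_space UNIV"
  proof (rule measurable_compose_countable'[where g = "\<lambda>v. v 0" and I = tuples
        and f = "\<lambda>s v. run N (next_graph E s) (\<lambda>i. v (Suc i))"])
    show "(\<lambda>v. run N (next_graph E s) (\<lambda>i. v (Suc i))) \<in> rounds.S \<rightarrow>\<^sub>M count_space UNIV" for s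
      by (rule measurable_compose[OF shift Suc])
    have "(\<lambda>v. v 0) \<in> rounds.S \<rightarrow>\<^sub>M uniform_count_measure tuples"
      by (rule measurable_component_singleton) simp
    then show "(\<lambda>v. v 0) \<in> rounds.S \<rightarrow>\<^sub>M count_space tuples"
      by (simp cong: measurable_cong_sets add: sets_uniform_count_measure_count_space)
    show "countable tuples" using finite_tuples by (rule countable_finite)
  qed
  then show ?case by (simp add: fun_eq_iff)
qed

lemma expectation_run:
  assumes "\<And>E. 0 \<le> f E"
  shows "(\<integral>\<^sup>+ v. ennreal (f (run N E v)) \<partial>process_space l n) = ennreal ((round_mean ^^ N) f E)
    \<and> 0 \<le> (round_mean ^^ N) f E"
  using assms
proof (induction N arbitrary: E)
  case 0
  then show ?case by (simp add: process_space_eq rounds.P.emeasure_space_1)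
next
  case (Suc N)
  let ?M = "uniform_count_measure tuples"
  let ?g = "\<lambda>v. ennreal (f (run (Suc N) E v))"
  have g: "?g \<in> borel_measurable rounds.S"
    by (rule measurable_compose[OF measurable_run]) simp
  have cn: "(\<lambda>(s, v). case_nat s v) \<in> ?M \<Otimes>\<^sub>M rounds.S \<rightarrow>\<^sub>M rounds.S"
    by measurable
  have "(\<integral>\<^sup>+ v. ?g v \<partial>process_space l n)
      = (\<integral>\<^sup>+ v. ?g v \<partial>distr (?M \<Otimes>\<^sub>M rounds.S) rounds.S (\<lambda>(s, v). case_nat s v))"
    by (simp only: process_space_eq rounds.PiM_iter)
  also have "\<dots> = (\<integral>\<^sup>+ p. ?g (case p of (s, v) \<Rightarrow> case_nat s v) \<partial>(?M \<Otimes>\<^sub>M rounds.S))"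
    using g by (intro nn_integral_distr cn) simp
  also have "\<dots> = (\<integral>\<^sup>+ s. \<integral>\<^sup>+ v. ?g (case_nat s v) \<partial>rounds.S \<partial>?M)"
    using measurable_compose[OF cn g] by (subst rounds.P.nn_integral_fst[symmetric]) (auto simp: split_beta')
  also have "\<dots> = (\<integral>\<^sup>+ s. ennreal ((round_mean ^^ N) f (next_graph E s)) \<partial>?M)"
    using Suc by (simp add: process_space_eq)
  also have "\<dots> = (\<Sum>s\<in>tuples. ennreal (1 / real (card tuples)) * ennreal ((round_mean ^^ N) f (next_graph E s)))"
    unfolding uniform_count_measure_def
    by (subst nn_integral_point_measure_finite) (auto simp: finite_tuples)
  also have "\<dots> = (\<Sum>s\<in>tuples. ennreal (1 / real (card tuples) * (round_mean ^^ N) f (next_graph E s)))"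
    using Suc by (intro sum.cong refl ennreal_mult[symmetric]) auto
  also have "\<dots> = ennreal (\<Sum>s\<in>tuples. 1 / real (card tuples) * (round_mean ^^ N) f (next_graph E s))"
    using Suc by (intro sum_ennreal) auto
  also have "(\<Sum>s\<in>tuples. 1 / real (card tuples) * (round_mean ^^ N) f (next_graph E s))
      = (round_mean ^^ Suc N) f E"
    by (simp only: funpow.simps o_apply round_mean_def card_tuples of_nat_power sum_divide_distrib times_divide_eq_left mult_1)
  finally show ?case
    using round_mean_nonneg[of "(round_mean ^^ N) f" E] Suc by auto
qed

end

\<comment> \<open>Keeps \<open>{1..n}\<close> from being rewritten to \<open>{Suc 0..n}\<close>, so that facts about it apply.\<close>
declare One_nat_def [simp del]

section \<open>The chosen pair and tuples with one small vertex\<close>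

context rule_process
begin

abbreviation comp_of :: "nat set set \<Rightarrow> nat \<Rightarrow> nat set" where
  "comp_of \<equiv> component {1..n}"

abbreviation in_size :: "nat set \<Rightarrow> nat set set \<Rightarrow> nat set" where
  "in_size \<equiv> vertices_in {1..n}"

definition degenerate_sizes :: "nat set" where
  "degenerate_sizes = {k \<in> {1..K}. ex_k K l R k = 0}"

definition nondegenerate_sizes :: "nat set" where
  "nondegenerate_sizes = {k \<in> {1..K}. ex_k K l R k \<noteq> 0}"

definition chosen :: "nat set set \<Rightarrow> (nat \<Rightarrow> nat) \<Rightarrow> nat" where
  "chosen E v = R (\<lambda>j\<in>{1..l}. comp_size K {1..n} E (v j))"

abbreviation chosen_pair :: "nat set set \<Rightarrow> (nat \<Rightarrow> nat) \<Rightarrow> nat set" where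
  "chosen_pair E v \<equiv> {2 * chosen E v - 1, 2 * chosen E v}"

definition lone_profile :: "nat \<Rightarrow> nat \<Rightarrow> nat \<Rightarrow> csize" where
  "lone_profile k i = (\<lambda>j\<in>{1..l}. if j = i then Size k else Omega)"

lemma l_ge_2: "2 \<le> l"
  using l_ge_1 even_l by presburger

lemma power_split: "n * n ^ (l - 2) = n ^ (l - 1)"
proof -
  obtain m where "l = Suc (Suc m)"
    using l_ge_2 by (metis Suc_le_D numeral_2_eq_2 Suc_le_mono)
  then show ?thesis by (simp add: numeral_2_eq_2)
qed

lemma finite_in_size [simp]: "finite (in_size J E)"
  by (rule finite_subset[OF vertices_in_subset]) simp

lemma card_in_size_le: "card (in_size J E) \<le> n"
  using card_mono[OF _ vertices_in_subset[of "{1..n}" J E]] by simp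

lemma finite_comp [simp]: "finite (comp_of E u)"
  by (rule finite_subset[OF component_subset]) simp

lemma card_comp_pos: "u \<in> {1..n} \<Longrightarrow> 1 \<le> card (comp_of E u)"
  using component_self[of u "{1..n}" E] by (metis One_nat_def Suc_leI card_gt_0_iff empty_iff finite_comp)

lemma in_small_iff: "u \<in> {1..n} \<Longrightarrow> u \<in> in_size {1..K} E \<longleftrightarrow> comp_size K {1..n} E u \<noteq> Omega"
  using card_comp_pos[of u E] by (auto simp: vertices_in_def comp_size_def)

lemma tuple_in: "v \<in> tuples \<Longrightarrow> j \<in> {1..l} \<Longrightarrow> v j \<in> {1..n}"
  unfolding tuples_def by (rule PiE_mem)

lemma rule_range: "s \<in> S_tuples K l \<Longrightarrow> 2 * R s - 1 \<in> {1..l} \<and> 2 * R s \<in> {1..l} \<and> 2 * R s - 1 \<noteq> 2 * R s"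
proof -
  assume "s \<in> S_tuples K l"
  then have "R s \<in> {1..l div 2}" using is_rule by (auto simp: is_rule_def)
  then show ?thesis by auto
qed

lemma profile_in: "v \<in> tuples \<Longrightarrow> (\<lambda>j\<in>{1..l}. comp_size K {1..n} E (v j)) \<in> S_tuples K l"
  unfolding S_tuples_def using tuple_in card_comp_pos
  by (auto simp: S_def comp_size_def)

lemma chosen_range:
  "v \<in> tuples \<Longrightarrow> 2 * chosen E v - 1 \<in> {1..l} \<and> 2 * chosen E v \<in> {1..l} \<and> 2 * chosen E v - 1 \<noteq> 2 * chosen E v"
  unfolding chosen_def by (rule rule_range[OF profile_in])

lemma next_graph_eq:
  "next_graph E v = add_edge (v (2 * chosen E v - 1)) (v (2 * chosen E v)) E"
  by (simp add: step_def chosen_def Let_def)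

lemma ends_in:
  "v \<in> tuples \<Longrightarrow> v (2 * chosen E v - 1) \<in> {1..n} \<and> v (2 * chosen E v) \<in> {1..n}"
  using chosen_range tuple_in by blast

text \<open>The tuples counted by \<open>ex_k\<close> are the profiles with a single entry \<open>k\<close>, at some slot \<open>i\<close>, for which the rule
  picks the pair containing \<open>i\<close>. Degeneracy of \<open>k\<close> says that the rule always avoids this slot.\<close>

lemma ex_k_eq_0_iff:
  assumes "k \<in> {1..K}"
  shows "ex_k K l R k = 0 \<longleftrightarrow>
    (\<forall>i\<in>{1..l}. i \<notin> {2 * R (lone_profile k i) - 1, 2 * R (lone_profile k i)})"
proof -
  let ?Q = "{s \<in> C K l R (Size k) Omega.
                \<exists>i\<in>{1..l}. s i = Size k \<and> (\<forall>j\<in>{1..l} - {i}. s j = Omega)}"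
  have "finite (S_tuples K l)"
    unfolding S_tuples_def S_def by (intro finite_PiE) auto
  then have "finite ?Q" by (rule finite_subset[rotated]) (auto simp: C_def)
  then have "ex_k K l R k = 0 \<longleftrightarrow> ?Q = {}"
    using assms by (simp add: ex_k_def)
  also have "\<dots> \<longleftrightarrow> (\<forall>i\<in>{1..l}. lone_profile k i \<notin> C K l R (Size k) Omega)"
  proof -
    have "s = lone_profile k i" if "s \<in> S_tuples K l" "s i = Size k" "\<forall>j\<in>{1..l} - {i}. s j = Omega"
      "i \<in> {1..l}" for s i
      using that unfolding lone_profile_def S_tuples_def
      by (intro ext) (auto simp: restrict_def PiE_def extensional_def)
    then have "s \<in> ?Q \<Longrightarrow> \<exists>i\<in>{1..l}. s = lone_profile k i" for s
      unfolding C_def by blast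
    moreover have "lone_profile k i i = Size k \<and> (\<forall>j\<in>{1..l} - {i}. lone_profile k i j = Omega)"
      if "i \<in> {1..l}" for i
      using that by (auto simp: lone_profile_def)
    ultimately show ?thesis by blast
  qed
  also have "\<dots> \<longleftrightarrow>
    (\<forall>i\<in>{1..l}. i \<notin> {2 * R (lone_profile k i) - 1, 2 * R (lone_profile k i)})"
  proof (intro ball_cong refl)
    fix i assume i: "i \<in> {1..l}"
    have s: "lone_profile k i \<in> S_tuples K l"
      using assms by (auto simp: lone_profile_def S_tuples_def S_def)
    show "lone_profile k i \<notin> C K l R (Size k) Omega \<longleftrightarrow>
      i \<notin> {2 * R (lone_profile k i) - 1, 2 * R (lone_profile k i)}"
      using s rule_range[OF s] unfolding C_def
      by (auto simp: lone_profile_def doubleton_eq_iff)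
  qed
  finally show ?thesis .
qed

lemma lone_tuple_profile:
  assumes "v \<in> tuples" "i \<in> {1..l}" "v i \<in> in_size {k} E" "k \<in> {1..K}"
    and "\<forall>j\<in>{1..l} - {i}. v j \<notin> in_size {1..K} E"
  shows "chosen E v = R (lone_profile k i)"
proof -
  have "(\<lambda>j\<in>{1..l}. comp_size K {1..n} E (v j)) = lone_profile k i"
  proof
    fix j show "(\<lambda>j\<in>{1..l}. comp_size K {1..n} E (v j)) j = lone_profile k i j"
      using assms tuple_in[OF assms(1), of j] in_small_iff[of "v j" E]
      by (auto simp: lone_profile_def comp_size_def vertices_in_def)
  qed
  then show ?thesis by (simp add: chosen_def)
qed

text \<open>If all other vertices of the tuple were large, the rule would see the lone profile of a degenerate size
  and would not pick the pair with the small vertex.\<close>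

lemma degenerate_loss_needs_two_small:
  assumes v: "v \<in> tuples"
    and loss: "\<not> in_size degenerate_sizes E \<subseteq> in_size degenerate_sizes (next_graph E v)"
  shows "\<exists>i\<in>{1..l}. \<exists>j\<in>{1..l}. i \<noteq> j \<and> v i \<in> in_size degenerate_sizes E \<and> v j \<in> in_size {1..K} E"
proof -
  let ?u = "v (2 * chosen E v - 1)" and ?w = "v (2 * chosen E v)"
  have "?u \<in> in_size degenerate_sizes E \<or> ?w \<in> in_size degenerate_sizes E"
    using loss vertices_in_mono[of ?u "{1..n}" ?w E degenerate_sizes] ends_in[OF v, of E]
    unfolding next_graph_eq by auto
  then obtain i where "i \<in> chosen_pair E v" "v i \<in> in_size degenerate_sizes E"
    by blast
  moreover from this have "i \<in> {1..l}"
    using chosen_range[OF v, of E] by blast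
  ultimately have i: "i \<in> {1..l}" "i \<in> chosen_pair E v" "v i \<in> in_size degenerate_sizes E"
    by blast+
  then obtain k where k: "k \<in> degenerate_sizes" "v i \<in> in_size {k} E"
    by (auto simp: vertices_in_def)
  have "\<exists>j\<in>{1..l} - {i}. v j \<in> in_size {1..K} E"
  proof (rule ccontr)
    assume "\<not> ?thesis"
    then have "chosen E v = R (lone_profile k i)"
      using lone_tuple_profile[OF v i(1) k(2)] k(1) by (auto simp: degenerate_sizes_def)
    then show False
      using ex_k_eq_0_iff[of k] k(1) i by (auto simp: degenerate_sizes_def)
  qed
  then obtain j where j: "j \<in> {1..l}" "j \<noteq> i" "v j \<in> in_size {1..K} E"
    by (elim bexE) (rule that, simp_all)
  show ?thesis
    by (rule bexI[OF _ i(1)], rule bexI[OF _ j(1)]) (use i(3) j(2,3) in simp)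
qed

text \<open>For a nondegenerate size \<open>k\<close>, a slot at which a lone vertex in a component of size \<open>k\<close> gets joined to a large
  component.\<close>

definition lone_slot :: "nat \<Rightarrow> nat" where
  "lone_slot k = (SOME i. i \<in> {1..l} \<and> i \<in> {2 * R (lone_profile k i) - 1, 2 * R (lone_profile k i)})"

lemma lone_slot:
  assumes "k \<in> nondegenerate_sizes"
  shows "lone_slot k \<in> {1..l}"
    "lone_slot k \<in> {2 * R (lone_profile k (lone_slot k)) - 1, 2 * R (lone_profile k (lone_slot k))}"
proof -
  have "\<exists>i. i \<in> {1..l} \<and> i \<in> {2 * R (lone_profile k i) - 1, 2 * R (lone_profile k i)}"
    using assms ex_k_eq_0_iff[of k] by (auto simp: nondegenerate_sizes_def)
  from someI_ex[OF this] show "lone_slot k \<in> {1..l}"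
    "lone_slot k \<in> {2 * R (lone_profile k (lone_slot k)) - 1, 2 * R (lone_profile k (lone_slot k))}"
    unfolding lone_slot_def by blast+
qed

section \<open>Counting tuples\<close>

lemma card_one_coordinate:
  assumes "i \<in> {1..l}"
  shows "card (PiE {1..l} (\<lambda>m. if m = i then A else B)) = card A * card B ^ (l - 1)"
proof -
  have "(\<Prod>m\<in>{1..l}. card (if m = i then A else B))
      = card A * (\<Prod>m\<in>{1..l} - {i}. card (if m = i then A else B))"
    using assms by (subst prod.remove[of _ i]) auto
  also have "(\<Prod>m\<in>{1..l} - {i}. card (if m = i then A else B)) = (\<Prod>m\<in>{1..l} - {i}. card B)"
    by (intro prod.cong) auto
  finally show ?thesis using assms by (simp add: card_PiE)
qed

lemma card_two_coordinates:
  assumes "i \<in> {1..l}" "j \<in> {1..l}" "i \<noteq> j" "A \<subseteq> {1..n}" "B \<subseteq> {1..n}"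
  shows "card {v \<in> tuples. v i \<in> A \<and> v j \<in> B} = card A * card B * n ^ (l - 2)"
proof -
  let ?T = "\<lambda>m. if m = i then A else if m = j then B else {1..n}"
  have e: "{v \<in> tuples. v i \<in> A \<and> v j \<in> B} = PiE {1..l} ?T"
  proof (intro set_eqI iffI)
    fix v assume v: "v \<in> PiE {1..l} ?T"
    then have "v m \<in> ?T m" if "m \<in> {1..l}" for m using that by (rule PiE_mem)
    moreover have "?T m \<subseteq> {1..n}" for m using assms(4,5) by simp
    ultimately have "v m \<in> {1..n}" if "m \<in> {1..l}" for m using that by blast
    then have "v \<in> tuples" using v unfolding tuples_def by (simp add: PiE_def Pi_def)
    moreover have "v i \<in> A" "v j \<in> B" using PiE_mem[OF v assms(1)] PiE_mem[OF v assms(2)] assms(3) by simp_all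
    ultimately show "v \<in> {v \<in> tuples. v i \<in> A \<and> v j \<in> B}" by simp
  next
    fix v assume "v \<in> {v \<in> tuples. v i \<in> A \<and> v j \<in> B}"
    then show "v \<in> PiE {1..l} ?T" by (auto simp: tuples_def PiE_def Pi_def)
  qed
  have "(\<Prod>m\<in>{1..l}. card (?T m)) = card A * (\<Prod>m\<in>{1..l} - {i}. card (?T m))"
    using assms by (subst prod.remove[of _ i]) auto
  also have "(\<Prod>m\<in>{1..l} - {i}. card (?T m)) = card B * (\<Prod>m\<in>{1..l} - {i} - {j}. card (?T m))"
    using assms by (subst prod.remove[of _ j]) auto
  also have "(\<Prod>m\<in>{1..l} - {i} - {j}. card (?T m)) = (\<Prod>m\<in>{1..l} - {i} - {j}. n)"
    by (intro prod.cong) auto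
  also have "\<dots> = n ^ (l - 2)"
    using assms by (simp add: card_Diff_subset numeral_2_eq_2 One_nat_def)
  finally show ?thesis unfolding e by (subst card_PiE) (simp_all add: mult.assoc)
qed

lemma card_some_pair:
  assumes "\<And>i j. i \<in> {1..l} \<Longrightarrow> j \<in> {1..l} \<Longrightarrow> i \<noteq> j \<Longrightarrow> card {v \<in> tuples. P (v i) (v j)} \<le> c"
  shows "card {v \<in> tuples. \<exists>i\<in>{1..l}. \<exists>j\<in>{1..l}. i \<noteq> j \<and> P (v i) (v j)} \<le> l\<^sup>2 * c"
proof -
  let ?I = "{p \<in> {1..l} \<times> {1..l}. fst p \<noteq> snd p}"
  have fin: "finite ?I" by (rule finite_subset[of _ "{1..l} \<times> {1..l}"]) auto
  have "{v \<in> tuples. \<exists>i\<in>{1..l}. \<exists>j\<in>{1..l}. i \<noteq> j \<and> P (v i) (v j)}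
      \<subseteq> (\<Union>p\<in>?I. {v \<in> tuples. P (v (fst p)) (v (snd p))})"
  proof
    fix v assume "v \<in> {v \<in> tuples. \<exists>i\<in>{1..l}. \<exists>j\<in>{1..l}. i \<noteq> j \<and> P (v i) (v j)}"
    then obtain i j where "v \<in> tuples" "i \<in> {1..l}" "j \<in> {1..l}" "i \<noteq> j" "P (v i) (v j)"
      by (elim CollectE conjE bexE)
    then show "v \<in> (\<Union>p\<in>?I. {v \<in> tuples. P (v (fst p)) (v (snd p))})"
      by (intro UN_I[of "(i, j)"]) simp_all
  qed
  then have "card {v \<in> tuples. \<exists>i\<in>{1..l}. \<exists>j\<in>{1..l}. i \<noteq> j \<and> P (v i) (v j)}
      \<le> card (\<Union>p\<in>?I. {v \<in> tuples. P (v (fst p)) (v (snd p))})"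
    using fin finite_tuples by (intro card_mono) simp_all
  also have "\<dots> \<le> (\<Sum>p\<in>?I. card {v \<in> tuples. P (v (fst p)) (v (snd p))})"
    by (rule card_UN_le[OF fin])
  also have "\<dots> \<le> (\<Sum>p\<in>?I. c)"
  proof (intro sum_mono)
    fix p assume "p \<in> ?I"
    then show "card {v \<in> tuples. P (v (fst p)) (v (snd p))} \<le> c"
      by (intro assms) (simp_all add: mem_Times_iff)
  qed
  also have "\<dots> \<le> card ({1..l} \<times> {1..l}) * c"
  proof -
    have "card ?I \<le> card ({1..l} \<times> {1..l})" by (intro card_mono) auto
    then show ?thesis by (simp only: sum_constant of_nat_id mult_right_mono)
  qed
  finally show ?thesis by (simp add: power2_eq_square)
qed

text \<open>Tuples whose two chosen ends may lie in the same small component are negligible: they cost a factor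
  \<open>K/n\<close>.\<close>

lemma card_same_component:
  "card {v \<in> tuples. \<exists>i\<in>{1..l}. \<exists>j\<in>{1..l}. i \<noteq> j \<and> (v i \<in> in_size {1..K} E \<and> v j \<in> comp_of E (v i))}
    \<le> l\<^sup>2 * (K * n ^ (l - 1))"
proof (rule card_some_pair[where P = "\<lambda>x y. x \<in> in_size {1..K} E \<and> y \<in> comp_of E x"])
  fix i j assume ij: "i \<in> {1..l}" "j \<in> {1..l}" "i \<noteq> j"
  have "{v \<in> tuples. v i \<in> in_size {1..K} E \<and> v j \<in> comp_of E (v i)}
    = (\<Union>u\<in>in_size {1..K} E. {v \<in> tuples. v i \<in> {u} \<and> v j \<in> comp_of E u})" by auto
  also have "card \<dots> \<le> (\<Sum>u\<in>in_size {1..K} E. card {v \<in> tuples. v i \<in> {u} \<and> v j \<in> comp_of E u})"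
    by (rule card_UN_le) simp
  also have "\<dots> \<le> (\<Sum>u\<in>in_size {1..K} E. K * n ^ (l - 2))"
  proof (intro sum_mono)
    fix u assume u: "u \<in> in_size {1..K} E"
    have "card {v \<in> tuples. v i \<in> {u} \<and> v j \<in> comp_of E u} = card {u} * card (comp_of E u) * n ^ (l - 2)"
      using u by (intro card_two_coordinates ij component_subset) (auto simp: vertices_in_def)
    also have "\<dots> \<le> K * n ^ (l - 2)"
      using u by (simp add: vertices_in_def)
    finally show "card {v \<in> tuples. v i \<in> {u} \<and> v j \<in> comp_of E u} \<le> K * n ^ (l - 2)" .
  qed
  also have "\<dots> \<le> n * (K * n ^ (l - 2))"
    using card_in_size_le[of "{1..K}" E] by simp
  also have "\<dots> = K * n ^ (l - 1)"
    using power_split by (simp only: mult.left_commute)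
  finally show "card {v \<in> tuples. v i \<in> in_size {1..K} E \<and> v j \<in> comp_of E (v i)} \<le> K * n ^ (l - 1)" .
qed

definition merging :: "nat set set \<Rightarrow> (nat \<Rightarrow> nat) set" where
  "merging E = {v \<in> tuples. comp_of E (v (2 * chosen E v - 1)) \<noteq> comp_of E (v (2 * chosen E v))}"

lemma finite_merging [simp]: "finite (merging E)"
  using finite_tuples by (simp add: merging_def)

text \<open>A tuple of small vertices without a repeated component merges two components whatever pair is
  chosen.\<close>

lemma card_merging_many_small:
  "card (in_size {1..K} E) ^ l \<le> card (merging E) + l\<^sup>2 * (K * n ^ (l - 1))"
proof -
  let ?X = "in_size {1..K} E"
  let ?B = "{v \<in> tuples. \<exists>i\<in>{1..l}. \<exists>j\<in>{1..l}. i \<noteq> j \<and> (v i \<in> ?X \<and> v j \<in> comp_of E (v i))}"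
  have "PiE {1..l} (\<lambda>_. ?X) \<subseteq> merging E \<union> ?B"
  proof
    fix v assume "v \<in> PiE {1..l} (\<lambda>_. ?X)"
    then have v: "v \<in> tuples" "\<And>j. j \<in> {1..l} \<Longrightarrow> v j \<in> ?X"
      using vertices_in_subset[of "{1..n}" "{1..K}" E] unfolding tuples_def by (auto simp: PiE_iff)
    show "v \<in> merging E \<union> ?B"
    proof (cases "v \<in> merging E")
      case False
      then have "comp_of E (v (2 * chosen E v - 1)) = comp_of E (v (2 * chosen E v))"
        using v by (auto simp: merging_def)
      then have "v (2 * chosen E v) \<in> comp_of E (v (2 * chosen E v - 1))"
        using component_self ends_in[OF v(1), of E] by metis
      then show ?thesis using v chosen_range[OF v(1), of E] by blast
    qed simp
  qed
  then have "card (PiE {1..l} (\<lambda>_. ?X)) \<le> card (merging E \<union> ?B)"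
    using finite_tuples by (intro card_mono) auto
  also have "\<dots> \<le> card (merging E) + card ?B" by (rule card_Un_le)
  also have "card ?B \<le> l\<^sup>2 * (K * n ^ (l - 1))" by (rule card_same_component)
  finally show ?thesis by (simp add: card_PiE)
qed

text \<open>Each nondegenerate small vertex \<open>u\<close> is put at the lone slot of its size and the other slots are filled
  with large vertices. These tuples are merging, and they differ for different \<open>u\<close> because \<open>u\<close> is the only
  small vertex of the tuple.\<close>

lemma card_merging_few_small:
  "card (in_size nondegenerate_sizes E) * (n - card (in_size {1..K} E)) ^ (l - 1) \<le> card (merging E)"
proof -
  let ?X = "in_size {1..K} E" and ?A = "in_size nondegenerate_sizes E"
  let ?slot = "\<lambda>u. lone_slot (card (comp_of E u))"
  let ?T = "\<lambda>u. PiE {1..l} (\<lambda>m. if m = ?slot u then {u} else {1..n} - ?X)"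
  have slot: "?slot u \<in> {1..l}" if "u \<in> ?A" for u
    using that by (intro lone_slot) (simp add: vertices_in_def)
  have AX: "?A \<subseteq> ?X" by (auto simp: vertices_in_def nondegenerate_sizes_def)
  have val: "v (?slot u) = u" "\<And>j. j \<in> {1..l} - {?slot u} \<Longrightarrow> v j \<in> {1..n} - ?X"
    if "u \<in> ?A" "v \<in> ?T u" for u v
  proof -
    have v: "v m \<in> (if m = ?slot u then {u} else {1..n} - ?X)" if "m \<in> {1..l}" for m
      using \<open>v \<in> ?T u\<close> that by (rule PiE_mem)
    show "v (?slot u) = u" using v[OF slot[OF \<open>u \<in> ?A\<close>]] by simp
    show "v j \<in> {1..n} - ?X" if "j \<in> {1..l} - {?slot u}" for j
      using v[of j] that by (simp split: if_splits)
  qed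
  have "card ?A * (n - card ?X) ^ (l - 1) = (\<Sum>u\<in>?A. card (?T u))"
    using slot by (subst sum.cong[OF refl card_one_coordinate])
      (simp_all add: card_Diff_subset vertices_in_subset)
  also have "\<dots> = card (\<Union>u\<in>?A. ?T u)"
  proof (rule card_UN_disjoint[symmetric])
    show "\<forall>u\<in>?A. finite (?T u)" by (intro ballI finite_PiE) auto
    show "\<forall>u\<in>?A. \<forall>w\<in>?A. u \<noteq> w \<longrightarrow> ?T u \<inter> ?T w = {}"
    proof (intro ballI impI)
      fix u w assume uw: "u \<in> ?A" "w \<in> ?A" "u \<noteq> w"
      show "?T u \<inter> ?T w = {}"
      proof (rule ccontr)
        assume "?T u \<inter> ?T w \<noteq> {}"
        then obtain v where v: "v \<in> ?T u" "v \<in> ?T w" by blast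
        have "?slot u \<noteq> ?slot w" using val(1)[OF uw(1) v(1)] val(1)[OF uw(2) v(2)] uw(3) by metis
        then have "v (?slot u) \<notin> ?X" using val(2)[OF uw(2) v(2), of "?slot u"] slot[OF uw(1)] by blast
        then show False using val(1)[OF uw(1) v(1)] uw(1) AX by auto
      qed
    qed
  qed simp
  also have "\<dots> \<le> card (merging E)"
  proof (rule card_mono, simp, rule)
    fix v assume "v \<in> (\<Union>u\<in>?A. ?T u)"
    then obtain u where u: "u \<in> ?A" "v \<in> ?T u" by blast
    note s = slot[OF u(1)] and w = val[OF u]
    have v: "v \<in> tuples"
    proof -
      have "u \<in> {1..n}" using u(1) by (simp add: vertices_in_def)
      then have "v j \<in> {1..n}" if "j \<in> {1..l}" for j
        using w that by (cases "j = ?slot u") simp_all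
      then show ?thesis using u(2) unfolding tuples_def by (simp add: PiE_def Pi_def)
    qed
    have k: "card (comp_of E u) \<in> nondegenerate_sizes" using u(1) by (simp add: vertices_in_def)
    have "chosen E v = R (lone_profile (card (comp_of E u)) (?slot u))"
      using u(1) w k by (intro lone_tuple_profile[OF v s])
        (auto simp: vertices_in_def nondegenerate_sizes_def)
    then have "?slot u \<in> chosen_pair E v" using lone_slot(2)[OF k] by simp
    then have slot_cases: "2 * chosen E v - 1 = ?slot u \<or> 2 * chosen E v = ?slot u" by force
    have other: "comp_of E (v j) \<noteq> comp_of E u" if "j \<in> {1..l} - {?slot u}" for j
      using w(2)[OF that] u(1) AX unfolding vertices_in_def by force
    have "comp_of E (v (2 * chosen E v - 1)) \<noteq> comp_of E (v (2 * chosen E v))"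
      using slot_cases
    proof
      assume "2 * chosen E v - 1 = ?slot u"
      then show ?thesis using other[of "2 * chosen E v"] chosen_range[OF v, of E] w(1) by simp
    next
      assume "2 * chosen E v = ?slot u"
      then show ?thesis using other[of "2 * chosen E v - 1"] chosen_range[OF v, of E] w(1) by simp
    qed
    then show "v \<in> merging E" using v by (simp add: merging_def)
  qed
  finally show ?thesis .
qed

text \<open>If at least half of the vertices are small, a constant fraction of all tuples is merging; otherwise
  at least half of the vertices are large and may fill the remaining slots. The lower bound on \<open>n\<close> makes
  the error term of \<open>card_merging_many_small\<close> at most half of its main term.\<close>

lemma card_merging:
  assumes "2 ^ Suc l * l\<^sup>2 * K \<le> n"
  shows "real (card (in_size nondegenerate_sizes E)) * real n ^ (l - 1) / 2 ^ Suc l \<le> real (card (merging E))"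
proof -
  let ?x = "card (in_size {1..K} E)" and ?a = "card (in_size nondegenerate_sizes E)"
  have pw: "real n ^ l = real n * real n ^ (l - 1)" using l_ge_1 by (simp flip: power_Suc)
  show ?thesis
  proof (cases "n \<le> 2 * ?x")
    case True
    have "real n ^ l / 2 ^ l = (real n / 2) ^ l" by (simp add: power_divide)
    also have "\<dots> \<le> real ?x ^ l" using True by (intro power_mono) auto
    also have "\<dots> \<le> real (card (merging E)) + real (l\<^sup>2 * K) * real n ^ (l - 1)"
      using card_merging_many_small[of E] by (simp add: mult.assoc flip: of_nat_power of_nat_mult of_nat_add)
    finally have 1: "real n ^ l / 2 ^ l \<le> real (card (merging E)) + real (l\<^sup>2 * K) * real n ^ (l - 1)" .
    have "real (2 ^ Suc l * l\<^sup>2 * K) \<le> real n" using assms by (simp only: of_nat_le_iff)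
    then have "real (l\<^sup>2 * K) \<le> real n / 2 ^ Suc l" by (simp add: field_simps)
    then have "real (l\<^sup>2 * K) * real n ^ (l - 1) \<le> real n / 2 ^ Suc l * real n ^ (l - 1)"
      by (intro mult_right_mono) auto
    also have "\<dots> = real n ^ l / 2 ^ Suc l" by (simp add: pw)
    finally have "real n ^ l / 2 ^ Suc l \<le> real (card (merging E))"
      using 1 by simp
    moreover have "real ?a * real n ^ (l - 1) / 2 ^ Suc l \<le> real n ^ l / 2 ^ Suc l"
      using card_in_size_le by (simp add: pw divide_right_mono mult_right_mono)
    ultimately show ?thesis by simp
  next
    case False
    have "real ?a * real n ^ (l - 1) / 2 ^ Suc l \<le> real ?a * (real n ^ (l - 1) / 2 ^ (l - 1))"
      unfolding times_divide_eq_right[symmetric]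
      by (intro mult_left_mono divide_left_mono power_increasing) auto
    also have "\<dots> = real ?a * (real n / 2) ^ (l - 1)" by (simp add: power_divide)
    also have "\<dots> \<le> real ?a * real (n - ?x) ^ (l - 1)"
      using False by (intro mult_left_mono power_mono) auto
    also have "\<dots> \<le> real (card (merging E))"
      using card_merging_few_small[of E] by (simp flip: of_nat_power of_nat_mult)
    finally show ?thesis .
  qed
qed

section \<open>Iterated averages\<close>

lemma round_mean_mono:
  assumes "\<And>v. v \<in> tuples \<Longrightarrow> f (next_graph E v) \<le> g (next_graph E v)"
  shows "round_mean f E \<le> round_mean g E"
  unfolding round_mean_def using assms by (intro divide_right_mono sum_mono) auto

lemma round_mean_ge:
  assumes "\<And>v. v \<in> tuples \<Longrightarrow> g v \<le> f (next_graph E v)"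
  shows "(\<Sum>v\<in>tuples. g v) / real n ^ l \<le> round_mean f E"
  unfolding round_mean_def using assms by (intro divide_right_mono sum_mono) auto

lemma round_mean_affine:
  "round_mean (\<lambda>E. a * f E + b * g E + c) E = a * round_mean f E + b * round_mean g E + c"
  using n_ge_1
  by (simp add: round_mean_def sum.distrib card_tuples add_divide_distrib flip: sum_distrib_left)

lemma iterated_mean_affine:
  "(round_mean ^^ N) (\<lambda>E. a * f E + b * g E + c) E
    = a * (round_mean ^^ N) f E + b * (round_mean ^^ N) g E + c"
proof (induction N arbitrary: E)
  case (Suc N)
  have "(round_mean ^^ N) (\<lambda>E. a * f E + b * g E + c)
      = (\<lambda>E. a * (round_mean ^^ N) f E + b * (round_mean ^^ N) g E + c)"
    using Suc by (intro ext)
  then show ?case by (simp add: round_mean_affine)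
qed simp

text \<open>The set \<open>I m\<close> contains the graphs that can occur in round \<open>m\<close>; the functions need to be compared only
  there.\<close>

lemma iterated_mean_mono_on:
  assumes "E \<in> I M"
    and "\<And>m F v. F \<in> I m \<Longrightarrow> v \<in> tuples \<Longrightarrow> next_graph F v \<in> I (Suc m)"
    and "\<And>F. F \<in> I (M + N) \<Longrightarrow> f F \<le> g F"
  shows "(round_mean ^^ N) f E \<le> (round_mean ^^ N) g E"
  using assms(1,3)
proof (induction N arbitrary: E M)
  case (Suc N)
  show ?case unfolding funpow.simps o_apply
  proof (rule round_mean_mono)
    fix v assume "v \<in> tuples"
    then show "(round_mean ^^ N) f (next_graph E v) \<le> (round_mean ^^ N) g (next_graph E v)"
      using Suc.prems assms(2) by (intro Suc.IH[of _ "Suc M"]) auto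
  qed
qed simp

lemma iterated_mean_mono:
  assumes "\<And>F. f F \<le> g F"
  shows "(round_mean ^^ N) f E \<le> (round_mean ^^ N) g E"
  by (rule iterated_mean_mono_on[where I = "\<lambda>_. UNIV" and M = 0]) (use assms in auto)

lemma iterated_mean_drift:
  assumes "\<And>F. f F - c \<le> round_mean f F"
  shows "f E - real N * c \<le> (round_mean ^^ N) f E"
proof (induction N arbitrary: E)
  case (Suc N)
  have "f E - real (Suc N) * c \<le> round_mean f E - real N * c"
    using assms[of E] by (simp add: algebra_simps)
  also have "\<dots> = round_mean (\<lambda>F. 1 * f F + 0 * f F + - (real N * c)) E"
    by (subst round_mean_affine) simp
  also have "\<dots> \<le> round_mean ((round_mean ^^ N) f) E"
    using Suc by (intro round_mean_mono) simp
  finally show ?case by simp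
qed simp

section \<open>The potential\<close>

text \<open>With \<open>D = 2 * K\<close>, the largest number of vertices lost in a round, this is \<open>3 * D * (D + 1) * l\<^sup>2\<close>: the
  factor \<open>D * (D + 1)\<close> comes from \<open>ratio_drop\<close>, the number \<open>l\<^sup>2\<close> bounds the pairs of slots for the two small
  vertices, and \<open>3\<close> bounds \<open>exp (weight / n)\<close>.\<close>

definition loss_rate :: real where
  "loss_rate = 6 * real K * (2 * real K + 1) * (real l)\<^sup>2"

text \<open>Chosen such that the gain from merging components, at rate \<open>weight * a / (2 ^ Suc l * n\<^sup>2)\<close>, cancels the
  loss caused by the \<open>a\<close> nondegenerate small vertices.\<close>

definition weight :: real where
  "weight = 2 ^ Suc l * loss_rate"

definition potential :: "nat set set \<Rightarrow> real" where
  "potential E =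
    real (card (in_size degenerate_sizes E)) / (real (card (in_size degenerate_sizes E)) + 1)
      * exp (- weight * real (card (graph_components {1..n} E)) / real n)"

text \<open>The tuples of \<open>degenerate_loss_needs_two_small\<close>: only they can lower the number of vertices in components
  of degenerate size.\<close>

definition risky :: "nat set set \<Rightarrow> (nat \<Rightarrow> nat) set" where
  "risky E = {v \<in> tuples. \<exists>i\<in>{1..l}. \<exists>j\<in>{1..l}. i \<noteq> j \<and>
     (v i \<in> in_size degenerate_sizes E \<and> v j \<in> in_size {1..K} E)}"

text \<open>The map \<open>x \<mapsto> x / (x + 1)\<close> has derivative \<open>1 / (x + 1)\<^sup>2\<close>; on an interval of length at most \<open>k\<close> that ends in \<open>d\<close>,
  its secants exceed the derivative at \<open>d\<close> by at most the factor \<open>k + 1\<close>.\<close>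

lemma ratio_drop:
  fixes d d' :: nat and k :: real
  assumes "real d \<le> real d' + k" "0 \<le> k"
  shows "real d / (real d + 1) - k * (k + 1) / (real d + 1)\<^sup>2 \<le> real d' / (real d' + 1)"
proof (cases "d \<le> d'")
  case True
  then have "real d / (real d + 1) \<le> real d' / (real d' + 1)" by (simp add: field_simps)
  moreover have "0 \<le> k * (k + 1) / (real d + 1)\<^sup>2" using assms by simp
  ultimately show ?thesis by linarith
next
  case False
  have "real d + 1 \<le> (k + 1) * (real d' + 1)"
  proof -
    have "0 \<le> k * real d'" using assms by simp
    moreover have "(k + 1) * (real d' + 1) = k * real d' + k + real d' + 1" by (simp add: algebra_simps)
    ultimately show ?thesis using assms(1) by simp
  qed
  then have 1: "1 / (real d' + 1) \<le> (k + 1) / (real d + 1)"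
    by (simp add: field_simps)
  have "real d / (real d + 1) - real d' / (real d' + 1) = (real d - real d') / (real d + 1) * (1 / (real d' + 1))"
    by (simp add: field_simps)
  also have "\<dots> \<le> k / (real d + 1) * ((k + 1) / (real d + 1))"
    using assms 1 by (intro mult_mono divide_right_mono) auto
  also have "\<dots> = k * (k + 1) / (real d + 1)\<^sup>2" by (simp add: power2_eq_square)
  finally show ?thesis by linarith
qed

lemma card_risky:
  "card (risky E) \<le> l\<^sup>2 * (card (in_size degenerate_sizes E) * card (in_size {1..K} E) * n ^ (l - 2))"
  unfolding risky_def
proof (rule card_some_pair)
  fix i j assume "i \<in> {1..l}" "j \<in> {1..l}" "i \<noteq> j"
  then show "card {v \<in> tuples. v i \<in> in_size degenerate_sizes E \<and> v j \<in> in_size {1..K} E}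
      \<le> card (in_size degenerate_sizes E) * card (in_size {1..K} E) * n ^ (l - 2)"
    by (simp add: card_two_coordinates vertices_in_subset)
qed

lemma sum_indicator_tuples: "A \<subseteq> tuples \<Longrightarrow> (\<Sum>v\<in>tuples. indicator A v) = real (card A)"
  using finite_tuples
  by (simp add: indicator_def sum.If_cases Int_absorb1 flip: sum.inter_filter)

lemma loss_rate_nonneg: "0 \<le> loss_rate"
  by (simp add: loss_rate_def)

lemma weight_nonneg: "0 \<le> weight"
  by (simp add: weight_def loss_rate_nonneg)

text \<open>On a merging tuple \<open>Z\<close> drops by one, so that the exponential factor grows by at least \<open>1 + weight / n\<close>; on
  a risky tuple the ratio may drop as in \<open>ratio_drop\<close>. The two effects may coincide, whence the factor
  \<open>exp (weight / n)\<close> at the loss.\<close>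

lemma potential_step:
  fixes E :: "nat set set"
  assumes v: "v \<in> tuples"
  defines "d \<equiv> real (card (in_size degenerate_sizes E))"
  shows "exp (- weight * real (card (graph_components {1..n} E)) / real n) *
      (d / (d + 1) + d / (d + 1) * (weight / real n) * indicator (merging E) v
        - exp (weight / real n) * (2 * real K * (2 * real K + 1) / (d + 1)\<^sup>2) * indicator (risky E) v)
    \<le> potential (next_graph E v)"
proof -
  let ?Z = "real (card (graph_components {1..n} E))"
  let ?Z' = "real (card (graph_components {1..n} (next_graph E v)))"
  define d' where "d' = card (in_size degenerate_sizes (next_graph E v))"
  let ?h = "d / (d + 1)" and ?h' = "real d' / (real d' + 1)"
  let ?L = "2 * real K * (2 * real K + 1) / (d + 1)\<^sup>2"
  let ?\<delta> = "indicator (merging E) v :: real"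
  let ?u = "v (2 * chosen E v - 1)" and ?w = "v (2 * chosen E v)"
  have ends: "?u \<in> {1..n}" "?w \<in> {1..n}" using ends_in[OF v] by auto
  have d0: "0 \<le> d" by (simp add: d_def)
  have w0: "0 \<le> weight / real n" using weight_nonneg by simp
  have "?Z' + ?\<delta> \<le> ?Z"
    using card_graph_components_add_edge[OF _ ends, of E] v
    unfolding next_graph_eq by (auto simp: merging_def indicator_def split: if_splits)
  then have "weight / real n * (?Z' + ?\<delta>) \<le> weight / real n * ?Z"
    by (rule mult_left_mono[OF _ w0])
  then have "exp (- weight * ?Z / real n + weight / real n * ?\<delta>) \<le> exp (- weight * ?Z' / real n)"
    by (simp add: algebra_simps)
  then have Z: "exp (- weight * ?Z / real n) * exp (weight / real n * ?\<delta>) \<le> exp (- weight * ?Z' / real n)"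
    by (simp only: exp_add)
  have L0: "0 \<le> ?L" by simp
  have h0: "0 \<le> ?h" using d0 by simp
  have exp1: "?h * (1 + weight / real n * ?\<delta>) \<le> ?h * exp (weight / real n * ?\<delta>)"
    by (intro mult_left_mono exp_ge_add_one_self h0)
  have main: "?h + ?h * (weight / real n) * ?\<delta> - exp (weight / real n) * ?L * indicator (risky E) v
      \<le> ?h' * exp (weight / real n * ?\<delta>)"
  proof (cases "v \<in> risky E")
    case False
    then have "in_size degenerate_sizes E \<subseteq> in_size degenerate_sizes (next_graph E v)"
      using degenerate_loss_needs_two_small[OF v, of E] v unfolding risky_def by blast
    then have "d \<le> real d'" unfolding d_def d'_def by (simp add: card_mono)
    then have "?h \<le> ?h'" using d0 by (simp add: field_simps)
    then have "?h * exp (weight / real n * ?\<delta>) \<le> ?h' * exp (weight / real n * ?\<delta>)"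
      by (intro mult_right_mono) auto
    with exp1 False show ?thesis by (simp add: algebra_simps)
  next
    case True
    have "card (in_size degenerate_sizes E) \<le> d' + 2 * K"
      unfolding d'_def next_graph_eq
      by (rule card_vertices_in_lost) (use ends in \<open>auto simp: degenerate_sizes_def\<close>)
    then have "d \<le> real d' + 2 * real K" unfolding d_def by linarith
    then have "?h - ?L \<le> ?h'"
      unfolding d_def by (intro ratio_drop) auto
    then have 1: "(?h - ?L) * exp (weight / real n * ?\<delta>) \<le> ?h' * exp (weight / real n * ?\<delta>)"
      by (intro mult_right_mono) auto
    have "exp (weight / real n * ?\<delta>) \<le> exp (weight / real n)"
      using w0 by (auto simp: indicator_def)
    then have 2: "?L * exp (weight / real n * ?\<delta>) \<le> ?L * exp (weight / real n)"
      by (rule mult_left_mono[OF _ L0])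
    from 1 2 exp1 True show ?thesis by (simp add: algebra_simps)
  qed
  have "exp (- weight * ?Z / real n) * (?h + ?h * (weight / real n) * ?\<delta>
        - exp (weight / real n) * ?L * indicator (risky E) v)
      \<le> exp (- weight * ?Z / real n) * (?h' * exp (weight / real n * ?\<delta>))"
    by (rule mult_left_mono[OF main]) simp
  also have "\<dots> = ?h' * (exp (- weight * ?Z / real n) * exp (weight / real n * ?\<delta>))"
    by (simp only: ac_simps)
  also have "\<dots> \<le> ?h' * exp (- weight * ?Z' / real n)"
    by (rule mult_left_mono[OF Z]) simp
  finally show ?thesis by (simp only: potential_def d'_def)
qed

text \<open>Averaging \<open>potential_step\<close> with the bounds for the numbers of merging and risky tuples. The crucial estimate
  is \<open>d * (d + a) / (d + 1)\<^sup>2 \<le> 1 + d / (d + 1) * a\<close>: the term with \<open>a\<close> is absorbed by the gain from merging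
  and only \<open>loss_rate / n\<^sup>2\<close> remains.\<close>

lemma potential_drift:
  assumes n: "weight \<le> real n"
  shows "potential E - loss_rate / (real n)\<^sup>2 \<le> round_mean potential E"
proof -
  define d where "d = real (card (in_size degenerate_sizes E))"
  define a where "a = real (card (in_size nondegenerate_sizes E))"
  let ?e = "exp (- weight * real (card (graph_components {1..n} E)) / real n)"
  let ?h = "d / (d + 1)" and ?L = "2 * real K * (2 * real K + 1) / (d + 1)\<^sup>2"
  have n0: "0 < real n" using n_ge_1 by simp
  have d0: "0 \<le> d" and a0: "0 \<le> a" by (simp_all add: d_def a_def)
  have "real (2 ^ Suc l * l\<^sup>2 * K) * 1 \<le> real (2 ^ Suc l * l\<^sup>2 * K) * (6 * (2 * real K + 1))"
    by (rule mult_left_mono) auto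
  also have "\<dots> = weight" by (simp add: weight_def loss_rate_def)
  finally have "2 ^ Suc l * l\<^sup>2 * K \<le> n" using n by (simp only: mult_1_right of_nat_le_iff flip: of_nat_le_iff)
  then have M: "a * real n ^ (l - 1) / 2 ^ Suc l \<le> real (card (merging E))"
    unfolding a_def by (rule card_merging)
  have X: "real (card (in_size {1..K} E)) = d + a"
  proof -
    have "in_size {1..K} E = in_size degenerate_sizes E \<union> in_size nondegenerate_sizes E"
      by (auto simp: vertices_in_def degenerate_sizes_def nondegenerate_sizes_def)
    moreover have "in_size degenerate_sizes E \<inter> in_size nondegenerate_sizes E = {}"
      by (auto simp: vertices_in_def degenerate_sizes_def nondegenerate_sizes_def)
    ultimately show ?thesis by (simp add: card_Un_disjoint d_def a_def)
  qed
  have B: "real (card (risky E)) \<le> (real l)\<^sup>2 * (d * (d + a) * real n ^ (l - 2))"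
    using of_nat_mono[where ?'a = real, OF card_risky[of E]]
    by (simp only: of_nat_mult of_nat_power X d_def[symmetric])
  have pw1: "real n ^ l = real n * real n ^ (l - 1)" using l_ge_1 by (simp flip: power_Suc)
  have pw2: "real n ^ l = (real n)\<^sup>2 * real n ^ (l - 2)" using l_ge_2
    by (metis le_add_diff_inverse power_add)
  have e3: "exp (weight / real n) \<le> 3"
  proof -
    have "exp (weight / real n) \<le> exp 1" using n n0 by simp
    then show ?thesis using exp_le by linarith
  qed
  have gain: "?h * (weight / real n) * (a * real n ^ (l - 1) / 2 ^ Suc l)
      \<le> ?h * (weight / real n) * real (card (merging E))"
    using d0 weight_nonneg by (intro mult_left_mono M) auto
  \<comment> \<open>The choice of \<open>weight\<close> turns the gain into exactly the part of the loss that contains \<open>a\<close>.\<close>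
  have gain': "?h * (weight / real n) * (a * real n ^ (l - 1) / 2 ^ Suc l)
      = real n ^ l * (loss_rate * (?h * a) / (real n)\<^sup>2)"
  proof -
    have eq: "x * (w * q / N) * (a * P / w) = N * P * (q * (x * a) / N\<^sup>2)"
      if "w \<noteq> 0" "N \<noteq> 0" for x w q N P :: real
      using that by (simp add: power2_eq_square field_simps)
    show ?thesis using n0 unfolding pw1 weight_def by (intro eq) simp_all
  qed
  have "?L * (d * (d + a)) \<le> 2 * real K * (2 * real K + 1) * (1 + ?h * a)"
  proof -
    have "d * d / (d + 1)\<^sup>2 \<le> 1"
      using d0 by (simp add: power2_eq_square mult_mono)
    moreover have "d * a / (d + 1)\<^sup>2 \<le> ?h * a"
    proof -
      have "d * a / (d + 1)\<^sup>2 = ?h * a * (1 / (d + 1))" by (simp add: power2_eq_square)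
      also have "\<dots> \<le> ?h * a * 1" using d0 a0 by (intro mult_left_mono) auto
      finally show ?thesis by simp
    qed
    ultimately have "d * (d + a) / (d + 1)\<^sup>2 \<le> 1 + ?h * a"
      by (simp add: distrib_left add_divide_distrib)
    then have "2 * real K * (2 * real K + 1) * (d * (d + a) / (d + 1)\<^sup>2)
        \<le> 2 * real K * (2 * real K + 1) * (1 + ?h * a)"
      by (rule mult_left_mono) simp
    then show ?thesis by simp
  qed
  then have "3 * (real l)\<^sup>2 * (?L * (d * (d + a))) \<le> 3 * (real l)\<^sup>2 * (2 * real K * (2 * real K + 1) * (1 + ?h * a))"
    by (rule mult_left_mono) simp
  also have "\<dots> = loss_rate * (1 + ?h * a)" by (simp add: loss_rate_def)
  finally have "real n ^ l * (3 * (real l)\<^sup>2 * (?L * (d * (d + a))) / (real n)\<^sup>2)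
      \<le> real n ^ l * (loss_rate * (1 + ?h * a) / (real n)\<^sup>2)"
    by (intro mult_left_mono divide_right_mono) auto
  moreover have "exp (weight / real n) * ?L * real (card (risky E))
      \<le> 3 * ?L * ((real l)\<^sup>2 * (d * (d + a) * real n ^ (l - 2)))"
    using B e3 d0 by (intro mult_mono) auto
  moreover have "3 * ?L * ((real l)\<^sup>2 * (d * (d + a) * real n ^ (l - 2)))
      = real n ^ l * (3 * (real l)\<^sup>2 * (?L * (d * (d + a))) / (real n)\<^sup>2)"
    using n0 by (simp add: pw2)
  ultimately have loss: "exp (weight / real n) * ?L * real (card (risky E))
      \<le> real n ^ l * (loss_rate * (1 + ?h * a) / (real n)\<^sup>2)"
    by linarith
  have "real n ^ l * (?h - loss_rate / (real n)\<^sup>2)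
      = real n ^ l * ?h + real n ^ l * (loss_rate * (?h * a) / (real n)\<^sup>2)
        - real n ^ l * (loss_rate * (1 + ?h * a) / (real n)\<^sup>2)"
    by (simp add: distrib_left right_diff_distrib add_divide_distrib)
  also have "\<dots> \<le> real n ^ l * ?h + ?h * (weight / real n) * real (card (merging E))
        - exp (weight / real n) * ?L * real (card (risky E))"
    using gain gain' loss by linarith
  finally have key: "real n ^ l * (?h - loss_rate / (real n)\<^sup>2) \<le> \<dots>" .
  have sums: "(\<Sum>v\<in>tuples. indicator (merging E) v) = real (card (merging E))"
    "(\<Sum>v\<in>tuples. indicator (risky E) v) = real (card (risky E))"
    by (rule sum_indicator_tuples, fastforce simp: merging_def risky_def)+
  have "potential E - loss_rate / (real n)\<^sup>2 \<le> ?e * (?h - loss_rate / (real n)\<^sup>2)"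
  proof -
    have "?e * (loss_rate / (real n)\<^sup>2) \<le> 1 * (loss_rate / (real n)\<^sup>2)"
      using weight_nonneg loss_rate_nonneg by (intro mult_right_mono) auto
    then show ?thesis by (simp add: potential_def d_def right_diff_distrib mult.commute)
  qed
  also have "\<dots> = ?e * (real n ^ l * (?h - loss_rate / (real n)\<^sup>2)) / real n ^ l"
    using n0 by simp
  also have "\<dots> \<le> ?e * (real n ^ l * ?h + ?h * (weight / real n) * real (card (merging E))
        - exp (weight / real n) * ?L * real (card (risky E))) / real n ^ l"
    by (intro divide_right_mono mult_left_mono key) auto
  also have "\<dots> = (\<Sum>v\<in>tuples. ?e * (?h + ?h * (weight / real n) * indicator (merging E) v
        - exp (weight / real n) * ?L * indicator (risky E) v)) / real n ^ l"
    by (simp only: sums[symmetric] sum_distrib_left[symmetric] sum_subtractf sum.distrib sum_constant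
        card_tuples of_nat_power)
  also have "\<dots> \<le> round_mean potential E"
    by (rule round_mean_ge) (unfold d_def, rule potential_step)
  finally show ?thesis .
qed


section \<open>Growth of the components of each size\<close>

abbreviation size_count :: "nat \<Rightarrow> nat set set \<Rightarrow> real" where
  "size_count k E \<equiv> real (card (in_size {k} E))"

lemma prod_alternating:
  fixes x y :: nat
  shows "(\<Prod>m\<in>{1..2 * q}. if odd m then x else y) = (x * y) ^ q"
proof (induction q)
  case (Suc q)
  have "{1..2 * Suc q} = insert (2 * q + 2) (insert (2 * q + 1) {1..2 * q})" by auto
  then show ?case using Suc by (simp add: algebra_simps)
qed simp

lemma card_alternating:
  "card (PiE {1..l} (\<lambda>m. if odd m then A else B)) = (card A * card B) ^ (l div 2)"
proof -
  have "(\<Prod>m\<in>{1..l}. card (if odd m then A else B)) = (\<Prod>m\<in>{1..2 * (l div 2)}. if odd m then card A else card B)"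
    using even_l by (intro prod.cong) auto
  then show ?thesis by (simp only: card_PiE finite_atLeastAtMost prod_alternating)
qed

lemma card_coincidence:
  assumes "i \<in> {1..l}" "j \<in> {1..l}" "i \<noteq> j"
  shows "card {v \<in> tuples. v i = v j} \<le> n ^ (l - 1)"
proof -
  have "{v \<in> tuples. v i = v j} \<subseteq> (\<Union>u\<in>{1..n}. {v \<in> tuples. v i \<in> {u} \<and> v j \<in> {u}})"
    using tuple_in assms by auto
  then have "card {v \<in> tuples. v i = v j} \<le> card (\<Union>u\<in>{1..n}. {v \<in> tuples. v i \<in> {u} \<and> v j \<in> {u}})"
    using finite_tuples by (intro card_mono) auto
  also have "\<dots> \<le> (\<Sum>u\<in>{1..n}. card {v \<in> tuples. v i \<in> {u} \<and> v j \<in> {u}})"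
    by (rule card_UN_le) simp
  also have "\<dots> = (\<Sum>u\<in>{1..n}. n ^ (l - 2))"
    using assms by (intro sum.cong refl) (subst card_two_coordinates, auto)
  also have "\<dots> = n ^ (l - 1)"
    using power_split by simp
  finally show ?thesis .
qed

text \<open>Whichever pair the rule picks from such a tuple, it joins an isolated vertex to another component of size
  \<open>j - 1\<close>. For \<open>j = 2\<close> both vertices are isolated, and the last condition excludes a loop.\<close>

definition creating :: "nat \<Rightarrow> nat set set \<Rightarrow> (nat \<Rightarrow> nat) set" where
  "creating j E = {v \<in> tuples. \<forall>m\<in>{1..l div 2}. v (2 * m - 1) \<in> in_size {1} E \<and>
     v (2 * m) \<in> in_size {j - 1} E \<and> v (2 * m - 1) \<noteq> v (2 * m)}"

definition touching :: "nat \<Rightarrow> nat set set \<Rightarrow> (nat \<Rightarrow> nat) set" where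
  "touching j E = {v \<in> tuples. \<exists>i\<in>{1..l}. v i \<in> in_size {j} E}"

text \<open>Isolated vertices go to the odd slots and vertices in components of size \<open>j - 1\<close> to the even slots; the
  error term counts the tuples in which some pair is a loop.\<close>

lemma card_creating:
  "(card (in_size {1} E) * card (in_size {j - 1} E)) ^ (l div 2)
    \<le> card (creating j E) + l div 2 * n ^ (l - 1)"
proof -
  let ?T = "PiE {1..l} (\<lambda>m. if odd m then in_size {1} E else in_size {j - 1} E)"
  let ?U = "\<Union>m\<in>{1..l div 2}. {v \<in> tuples. v (2 * m - 1) = v (2 * m)}"
  have "?T \<subseteq> creating j E \<union> ?U"
  proof
    fix v assume v: "v \<in> ?T"
    then have mem: "v m \<in> (if odd m then in_size {1} E else in_size {j - 1} E)" if "m \<in> {1..l}" for m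
      using that by (rule PiE_mem)
    have t: "v \<in> tuples"
    proof -
      have "v m \<in> {1..n}" if "m \<in> {1..l}" for m
        using mem[OF that] by (auto simp: vertices_in_def split: if_splits)
      then show ?thesis using v unfolding tuples_def by (simp add: PiE_def Pi_def)
    qed
    have "v (2 * m - 1) \<in> in_size {1} E \<and> v (2 * m) \<in> in_size {j - 1} E" if "m \<in> {1..l div 2}" for m
    proof -
      have "2 * m - 1 \<in> {1..l}" "2 * m \<in> {1..l}" "odd (2 * m - 1)" using that by auto
      then show ?thesis using mem[of "2 * m - 1"] mem[of "2 * m"] by simp
    qed
    then show "v \<in> creating j E \<union> ?U" using t by (auto simp: creating_def)
  qed
  then have "card ?T \<le> card (creating j E \<union> ?U)"
    using finite_tuples by (intro card_mono) (auto simp: creating_def)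
  also have "\<dots> \<le> card (creating j E) + card ?U" by (rule card_Un_le)
  also have "card ?U \<le> (\<Sum>m\<in>{1..l div 2}. card {v \<in> tuples. v (2 * m - 1) = v (2 * m)})"
    by (rule card_UN_le) simp
  also have "\<dots> \<le> (\<Sum>m\<in>{1..l div 2}. n ^ (l - 1))"
    by (intro sum_mono card_coincidence) auto
  finally show ?thesis by (simp add: card_alternating)
qed

lemma card_touching: "card (touching j E) \<le> l * (card (in_size {j} E) * n ^ (l - 1))"
proof -
  have "touching j E \<subseteq> (\<Union>i\<in>{1..l}. PiE {1..l} (\<lambda>m. if m = i then in_size {j} E else {1..n}))"
    by (auto simp: touching_def tuples_def PiE_def Pi_def)
  then have "card (touching j E) \<le> card (\<Union>i\<in>{1..l}. PiE {1..l} (\<lambda>m. if m = i then in_size {j} E else {1..n}))"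
    by (intro card_mono finite_UN_I finite_PiE) auto
  also have "\<dots> \<le> (\<Sum>i\<in>{1..l}. card (PiE {1..l} (\<lambda>m. if m = i then in_size {j} E else {1..n})))"
    by (rule card_UN_le) simp
  also have "\<dots> = (\<Sum>i\<in>{1..l}. card (in_size {j} E) * n ^ (l - 1))"
    by (intro sum.cong refl) (simp add: card_one_coordinate)
  finally show ?thesis by simp
qed

text \<open>For a creating tuple neither end lies in a component of size \<open>j\<close>, so nothing is lost and the isolated end is
  gained. In general each end of the new edge can cost the vertices of its component, at most \<open>K\<close>, and only
  if that component has size \<open>j\<close>.\<close>

lemma size_count_step:
  assumes v: "v \<in> tuples" and j: "2 \<le> j" "j \<le> K"
  shows "size_count j E + indicator (creating j E) v - 2 * real K * indicator (touching j E) v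
    \<le> size_count j (next_graph E v)"
proof -
  let ?u = "v (2 * chosen E v - 1)" and ?w = "v (2 * chosen E v)"
  have ends: "?u \<in> {1..n}" "?w \<in> {1..n}" using ends_in[OF v] by auto
  show ?thesis
  proof (cases "v \<in> creating j E")
    case True
    have "chosen E v \<in> {1..l div 2}" using chosen_range[OF v, of E] by auto
    then have uw: "?u \<in> in_size {1} E" "?w \<in> in_size {j - 1} E" "?u \<noteq> ?w"
      using True by (auto simp: creating_def)
    have cu: "comp_of E ?u = {?u}"
    proof -
      have "card (comp_of E ?u) = 1" using uw(1) by (simp add: vertices_in_def)
      then obtain x where "comp_of E ?u = {x}" by (rule card_1_singletonE)
      then show ?thesis using component_self[OF ends(1), of E] by simp
    qed
    have nw: "?u \<notin> comp_of E ?w"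
      using component_eqI[of ?u "{1..n}" E ?w] cu component_self[OF ends(2), of E] uw(3)
      by (metis singletonD)
    have "comp_of (next_graph E v) ?u = insert ?u (comp_of E ?w)"
      using component_add_edge[OF ends ends(1), of E] cu by (simp add: next_graph_eq)
    then have new: "?u \<in> in_size {j} (next_graph E v)"
      using nw uw(2) j ends by (simp add: vertices_in_def)
    have old: "?u \<notin> in_size {j} E" "?w \<notin> in_size {j} E"
      using uw j by (auto simp: vertices_in_def)
    then have "in_size {j} E \<subseteq> in_size {j} (next_graph E v)"
      unfolding next_graph_eq using ends by (intro vertices_in_mono) auto
    then have "card (insert ?u (in_size {j} E)) \<le> card (in_size {j} (next_graph E v))"
      using new by (intro card_mono) auto
    then show ?thesis using True old(1) by (simp add: indicator_def)
  next
    case False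
    show ?thesis
    proof (cases "v \<in> touching j E")
      case True
      have "card (in_size {j} E) \<le> card (in_size {j} (next_graph E v)) + 2 * K"
        unfolding next_graph_eq by (rule card_vertices_in_lost) (use ends j in auto)
      then show ?thesis using True False by simp
    next
      case not_touching: False
      then have "?u \<notin> in_size {j} E" "?w \<notin> in_size {j} E"
        using v chosen_range[OF v, of E] by (auto simp: touching_def)
      then have "in_size {j} E \<subseteq> in_size {j} (next_graph E v)"
        unfolding next_graph_eq using ends by (intro vertices_in_mono) auto
      then have "card (in_size {j} E) \<le> card (in_size {j} (next_graph E v))" by (intro card_mono) auto
      then show ?thesis using False not_touching by simp
    qed
  qed
qed

text \<open>While at least half of the vertices are isolated, a round creates a component of size \<open>j\<close> with probability
  at least about \<open>(y / 2) ^ (l div 2)\<close>, where \<open>y\<close> is the fraction of vertices in components of size \<open>j - 1\<close>, and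
  it destroys one with probability proportional to their number.\<close>

lemma size_count_drift:
  assumes j: "2 \<le> j" "j \<le> K" and half: "n \<le> 2 * card (in_size {1} E)"
  shows "(1 - 2 * real K * real l / real n) * size_count j E
      + (size_count (j - 1) E / real n / 2) ^ (l div 2) - real (l div 2) / real n
    \<le> round_mean (size_count j) E"
proof -
  let ?p = "l div 2"
  have n0: "0 < real n" using n_ge_1 by simp
  have pw1: "real n ^ l = real n * real n ^ (l - 1)" using l_ge_1 by (simp flip: power_Suc)
  have pw2: "real n ^ l = (real n * real n) ^ ?p"
    using even_l by (metis dvd_mult_div_cancel power2_eq_square power_mult)
  have "real n ^ l * (size_count (j - 1) E / real n / 2) ^ ?p = (real n / 2 * size_count (j - 1) E) ^ ?p"
    using n0 unfolding pw2 power_mult_distrib[symmetric] by simp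
  also have "\<dots> \<le> (size_count 1 E * size_count (j - 1) E) ^ ?p"
    using half by (intro power_mono mult_right_mono) auto
  also have "\<dots> \<le> real (card (creating j E)) + real ?p * real n ^ (l - 1)"
    using of_nat_mono[where ?'a = real, OF card_creating[of E j]]
    by (simp only: of_nat_mult of_nat_power of_nat_add)
  finally have gain: "real n ^ l * ((size_count (j - 1) E / real n / 2) ^ ?p - real ?p / real n)
      \<le> real (card (creating j E))"
    using n0 by (simp add: right_diff_distrib pw1 mult.commute[of "real ?p"])
  have "real (card (touching j E)) \<le> real l * (size_count j E * real n ^ (l - 1))"
    using of_nat_mono[where ?'a = real, OF card_touching[of j E]]
    by (simp only: of_nat_mult of_nat_power)
  then have "2 * real K * real (card (touching j E)) \<le> 2 * real K * (real l * (size_count j E * real n ^ (l - 1)))"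
    by (rule mult_left_mono) simp
  also have "\<dots> = real n ^ l * (2 * real K * real l / real n * size_count j E)"
    using n0 by (simp add: pw1)
  finally have loss: "2 * real K * real (card (touching j E))
      \<le> real n ^ l * (2 * real K * real l / real n * size_count j E)" .
  have "real n ^ l * ((1 - 2 * real K * real l / real n) * size_count j E
      + (size_count (j - 1) E / real n / 2) ^ ?p - real ?p / real n)
    = real n ^ l * size_count j E - real n ^ l * (2 * real K * real l / real n * size_count j E)
      + real n ^ l * ((size_count (j - 1) E / real n / 2) ^ ?p - real ?p / real n)"
    by (simp only: left_diff_distrib right_diff_distrib distrib_left mult_1)
  also have "\<dots> \<le> real n ^ l * size_count j E + real (card (creating j E)) - 2 * real K * real (card (touching j E))"
    using gain loss by linarith
  also have "\<dots> = (\<Sum>v\<in>tuples. size_count j E + indicator (creating j E) v - 2 * real K * indicator (touching j E) v)"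
  proof -
    have "creating j E \<subseteq> tuples" "touching j E \<subseteq> tuples" by (auto simp: creating_def touching_def)
    then show ?thesis
      by (simp only: sum_indicator_tuples sum_distrib_left[symmetric] sum_subtractf sum.distrib sum_constant
        card_tuples of_nat_power)
  qed
  finally have "((1 - 2 * real K * real l / real n) * size_count j E
      + (size_count (j - 1) E / real n / 2) ^ ?p - real ?p / real n)
    \<le> (\<Sum>v\<in>tuples. size_count j E + indicator (creating j E) v - 2 * real K * indicator (touching j E) v) / real n ^ l"
    using n0 by (simp add: field_simps)
  also have "\<dots> \<le> round_mean (size_count j) E"
    by (rule round_mean_ge) (rule size_count_step[OF _ j])
  finally show ?thesis .
qed

lemma component_empty: "v \<in> {1..n} \<Longrightarrow> comp_of {} v = {v}"
  by (auto simp: component_def adj_def)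

lemma size_count_1_empty: "card (in_size {1} {}) = n"
proof -
  have "in_size {1} {} = {1..n}" by (auto simp: vertices_in_def component_empty)
  then show ?thesis by simp
qed

text \<open>Each edge removes at most two isolated vertices, so these graphs are all that occur after \<open>N\<close>
  rounds.\<close>

definition early :: "nat \<Rightarrow> nat set set set" where
  "early N = {E. n \<le> card (in_size {1} E) + 2 * N}"

lemma early_step:
  assumes "E \<in> early N" "v \<in> tuples"
  shows "next_graph E v \<in> early (Suc N)"
proof -
  have "card (in_size {1} E) \<le> card (in_size {1} (next_graph E v)) + 2 * 1"
    unfolding next_graph_eq by (rule card_vertices_in_lost) (use ends_in[OF assms(2), of E] in auto)
  then show ?thesis using assms(1) by (simp add: early_def)
qed

lemma iterated_mean_mono_early:
  assumes "\<And>E. E \<in> early N \<Longrightarrow> f E \<le> g E"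
  shows "(round_mean ^^ N) f {} \<le> (round_mean ^^ N) g {}"
proof (rule iterated_mean_mono_on[where I = early and M = 0])
  show "{} \<in> early 0" by (simp add: early_def size_count_1_empty)
qed (use assms early_step in auto)

lemma iterated_mean_const: "(round_mean ^^ N) (\<lambda>_. c) E = c"
  using iterated_mean_affine[of N 0 "\<lambda>_. 0" 0 "\<lambda>_. 0" c E] by simp

text \<open>A linear lower bound for a power, so that the mean of a power is bounded by the power of the
  mean up to a constant factor, without convexity arguments.\<close>

lemma power_ge_linear:
  fixes x t :: real
  assumes "0 \<le> x" "0 \<le> t"
  shows "t ^ p * (x - t) \<le> x ^ Suc p"
proof (cases "t \<le> x")
  case True
  then have "t ^ p * (x - t) \<le> x ^ p * x"
    using assms by (intro mult_mono power_mono) auto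
  then show ?thesis by (simp add: mult.commute)
next
  case False
  then have "t ^ p * (x - t) \<le> 0" using assms by (intro mult_nonneg_nonpos) auto
  also have "0 \<le> x ^ Suc p" using assms by simp
  finally show ?thesis .
qed

text \<open>Linearising the power in \<open>size_count_drift\<close> at \<open>\<theta>\<close>: since the mean of the fraction is at least
  \<open>4 * \<theta>\<close>, half of it has mean at least \<open>2 * \<theta>\<close>, which leaves a gain of \<open>\<theta> ^ (l div 2)\<close>, and the error term
  takes at most half of this.\<close>

lemma growth_recursion:
  assumes j: "2 \<le> j" "j \<le> K" and N: "4 * N \<le> n" and \<theta>: "0 < \<theta>"
    and prev: "4 * \<theta> * real n \<le> (round_mean ^^ N) (size_count (j - 1)) {}"
    and large: "real (l div 2) \<le> \<theta> ^ (l div 2) / 2 * real n"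
  shows "(1 - 2 * real K * real l / real n) * (round_mean ^^ N) (size_count j) {} + \<theta> ^ (l div 2) / 2
    \<le> (round_mean ^^ Suc N) (size_count j) {}"
proof -
  define q where "q = l div 2 - 1"
  have p: "l div 2 = Suc q" using l_ge_2 by (simp add: q_def)
  let ?a = "1 - 2 * real K * real l / real n"
  have n0: "0 < real n" using n_ge_1 by simp
  have "?a * size_count j E + \<theta> ^ q / real n / 2 * size_count (j - 1) E + (- (\<theta> ^ Suc q) - real (l div 2) / real n)
      \<le> round_mean (size_count j) E" if "E \<in> early N" for E
  proof -
    have "\<theta> ^ q * (size_count (j - 1) E / real n / 2 - \<theta>) \<le> (size_count (j - 1) E / real n / 2) ^ (l div 2)"
      unfolding p using \<theta> by (intro power_ge_linear) auto
    moreover have "n \<le> 2 * card (in_size {1} E)" using that N by (simp add: early_def)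
    ultimately show ?thesis using size_count_drift[OF j, of E]
      by (simp add: right_diff_distrib mult.commute)
  qed
  then have "(round_mean ^^ N) (\<lambda>E. ?a * size_count j E + \<theta> ^ q / real n / 2 * size_count (j - 1) E
      + (- (\<theta> ^ Suc q) - real (l div 2) / real n)) {} \<le> (round_mean ^^ N) (round_mean (size_count j)) {}"
    by (rule iterated_mean_mono_early)
  also have "\<dots> = (round_mean ^^ Suc N) (size_count j) {}"
    by (simp add: funpow_swap1)
  finally have mean: "?a * (round_mean ^^ N) (size_count j) {}
      + \<theta> ^ q / real n / 2 * (round_mean ^^ N) (size_count (j - 1)) {}
      + (- (\<theta> ^ Suc q) - real (l div 2) / real n) \<le> (round_mean ^^ Suc N) (size_count j) {}"
    by (simp only: iterated_mean_affine)
  have "\<theta> ^ q / real n / 2 * (4 * \<theta> * real n) \<le> \<theta> ^ q / real n / 2 * (round_mean ^^ N) (size_count (j - 1)) {}"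
    using prev \<theta> by (intro mult_left_mono) auto
  then have gain: "2 * \<theta> ^ Suc q \<le> \<theta> ^ q / real n / 2 * (round_mean ^^ N) (size_count (j - 1)) {}"
    using n0 by simp
  have loss: "real (l div 2) / real n \<le> \<theta> ^ Suc q / 2"
    using large n0 unfolding p by (simp add: field_simps)
  have "a + t / 2 \<le> z" if "a + c + (- t - r) \<le> z" "2 * t \<le> c" "r \<le> t / 2" for a c t r z :: real
    using that by linarith
  from this[OF mean gain loss] show ?thesis by (simp only: p)
qed

text \<open>With \<open>c = \<theta> ^ (l div 2) / 2\<close> and \<open>C = 2 * K * l\<close> the recursion is \<open>y\<^sub>N\<^sub>+\<^sub>1 \<ge> (1 - C / n) * y\<^sub>N + c\<close>. The
  linear function \<open>b * (N - N0)\<close> satisfies the opposite inequality for \<open>N - N0 \<le> n\<close> as soon as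
  \<open>b * (1 + C) \<le> c\<close>.\<close>

lemma growth_window:
  assumes j: "2 \<le> j" "j \<le> K" and \<theta>: "0 < \<theta>"
    and prev: "\<And>N. N0 \<le> N \<Longrightarrow> 4 * N \<le> n \<Longrightarrow> 4 * \<theta> * real n \<le> (round_mean ^^ N) (size_count (j - 1)) {}"
    and large: "real (l div 2) \<le> \<theta> ^ (l div 2) / 2 * real n" "2 * real K * real l \<le> real n"
    and N: "N0 \<le> N" "4 * N \<le> n"
  shows "\<theta> ^ (l div 2) / (2 * (1 + 2 * real K * real l)) * (real N - real N0)
    \<le> (round_mean ^^ N) (size_count j) {}"
  using N
proof (induction N rule: dec_induct)
  case base
  have "(round_mean ^^ N0) (\<lambda>_. 0) {} \<le> (round_mean ^^ N0) (size_count j) {}"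
    by (rule iterated_mean_mono) simp
  then show ?case by (simp add: iterated_mean_const)
next
  case (step N)
  let ?C = "2 * real K * real l" and ?c = "\<theta> ^ (l div 2) / 2"
  let ?b = "\<theta> ^ (l div 2) / (2 * (1 + ?C))"
  have n0: "0 < real n" using n_ge_1 by simp
  have C0: "0 \<le> ?C" by simp
  have b0: "0 \<le> ?b" using \<theta> by simp
  have eq: "x / (2 * y) * y = x / 2" if "0 < y" for x y :: real using that by simp
  have bc: "?b * (1 + ?C) = ?c" using C0 by (intro eq) linarith
  have N: "4 * N \<le> n" using step by simp
  have "?b * (real N - real N0) * (?C / real n) \<le> ?b * ?C"
  proof -
    have "(real N - real N0) / real n \<le> 1" using N n0 by (simp add: field_simps)
    then have "?b * ?C * ((real N - real N0) / real n) \<le> ?b * ?C * 1"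
      by (intro mult_left_mono mult_nonneg_nonneg b0 C0) auto
    then show ?thesis by (simp add: mult_ac)
  qed
  moreover have "b * (D + 1) \<le> (1 - c) * (b * D) + b * (1 + C)" if "b * D * c \<le> b * C" for b c C D :: real
    using that by (simp add: algebra_simps)
  ultimately have "?b * (real N - real N0 + 1) \<le> (1 - ?C / real n) * (?b * (real N - real N0)) + ?b * (1 + ?C)"
    by blast
  then have "?b * (real (Suc N) - real N0) \<le> (1 - ?C / real n) * (?b * (real N - real N0)) + ?b * (1 + ?C)"
    by (simp only: of_nat_Suc) (simp only: add_diff_eq add.commute)
  also have "\<dots> \<le> (1 - ?C / real n) * (round_mean ^^ N) (size_count j) {} + ?c"
    unfolding bc using step N large(2) n0 by (intro add_right_mono mult_left_mono) auto
  also have "\<dots> \<le> (round_mean ^^ Suc N) (size_count j) {}"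
    using step N by (intro growth_recursion j \<theta> prev large) auto
  finally show ?case .
qed

end

text \<open>The induction on \<open>k\<close> needs the claim for all \<open>\<tau>\<close>: components of size \<open>k\<close> are plentiful from round
  \<open>\<tau> * n / 2\<close> on, and those of size \<open>k + 1\<close> accumulate between \<open>\<tau> * n / 2\<close> and \<open>\<tau> * n\<close>.\<close>

lemma linear_growth:
  assumes rule: "1 \<le> l" "even l" "is_rule K l R"
    and k: "1 \<le> k" "k \<le> K" and \<tau>: "0 < \<tau>"
  shows "\<exists>c>0. \<forall>\<^sub>F n in sequentially. \<forall>N. \<tau> * real n \<le> real N \<longrightarrow> 4 * N \<le> n \<longrightarrow>
    c * real n \<le> (rule_process.round_mean K l R n ^^ N) (\<lambda>E. real (card (vertices_in {1..n} {k} E))) {}"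
  using k \<tau>
proof (induction k arbitrary: \<tau> rule: dec_induct)
  case base
  have "\<forall>\<^sub>F n in sequentially. \<forall>N. \<tau> * real n \<le> real N \<longrightarrow> 4 * N \<le> n \<longrightarrow>
    1 / 2 * real n \<le> (rule_process.round_mean K l R n ^^ N) (\<lambda>E. real (card (vertices_in {1..n} {1} E))) {}"
    using eventually_ge_at_top[of 1]
  proof eventually_elim
    case (elim n)
    interpret rule_process K l R n using rule elim by unfold_locales
    have "1 / 2 * real n \<le> (round_mean ^^ N) (size_count 1) {}" if "4 * N \<le> n" for N
    proof -
      have "(round_mean ^^ N) (\<lambda>_. 1 / 2 * real n) {} \<le> (round_mean ^^ N) (size_count 1) {}"
      proof (rule iterated_mean_mono_early)
        fix E assume "E \<in> early N"
        then have "n \<le> 2 * card (in_size {1} E)" using that by (simp add: early_def)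
        then show "1 / 2 * real n \<le> size_count 1 E" by linarith
      qed
      then show ?thesis by (simp only: iterated_mean_const)
    qed
    then show ?case by blast
  qed
  then show ?case by (intro exI[of _ "1 / 2"]) simp
next
  case (step k)
  have "0 < \<tau> / 2" "k \<le> K" using step by auto
  from step.IH[OF this(2,1)] obtain c where c: "0 < c"
    and ev: "\<forall>\<^sub>F n in sequentially. \<forall>N. \<tau> / 2 * real n \<le> real N \<longrightarrow> 4 * N \<le> n \<longrightarrow>
      c * real n \<le> (rule_process.round_mean K l R n ^^ N) (\<lambda>E. real (card (vertices_in {1..n} {k} E))) {}"
    by blast
  define \<theta> where "\<theta> = c / 4"
  have \<theta>: "0 < \<theta>" using c by (simp add: \<theta>_def)
  define b where "b = \<theta> ^ (l div 2) / (2 * (1 + 2 * real K * real l))"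
  have b: "0 < b" using \<theta> unfolding b_def
    by (intro divide_pos_pos zero_less_power mult_pos_pos add_pos_nonneg) auto
  have "\<forall>\<^sub>F n in sequentially. real (l div 2) / (\<theta> ^ (l div 2) / 2) \<le> real n"
    "\<forall>\<^sub>F n in sequentially. 2 * real K * real l \<le> real n"
    "\<forall>\<^sub>F n in sequentially. 4 / \<tau> \<le> real n"
    by (rule eventually_compose_filterlim[OF eventually_ge_at_top filterlim_real_sequentially])+
  with ev eventually_ge_at_top[of 1] have "\<forall>\<^sub>F n in sequentially. \<forall>N. \<tau> * real n \<le> real N \<longrightarrow> 4 * N \<le> n \<longrightarrow>
    b * (\<tau> / 4) * real n \<le> (rule_process.round_mean K l R n ^^ N) (\<lambda>E. real (card (vertices_in {1..n} {Suc k} E))) {}"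
  proof eventually_elim
    case (elim n)
    interpret rule_process K l R n using rule elim by unfold_locales
    define N0 where "N0 = nat \<lceil>\<tau> / 2 * real n\<rceil>"
    have N0: "\<tau> / 2 * real n \<le> real N0" "real N0 \<le> \<tau> / 2 * real n + 1"
    proof -
      have "0 \<le> \<tau> / 2 * real n" using step by simp
      then show "\<tau> / 2 * real n \<le> real N0" "real N0 \<le> \<tau> / 2 * real n + 1"
        unfolding N0_def by linarith+
    qed
    have "b * (\<tau> / 4) * real n \<le> (round_mean ^^ N) (size_count (Suc k)) {}"
      if N: "\<tau> * real n \<le> real N" "4 * N \<le> n" for N
    proof -
      have n\<tau>: "4 \<le> \<tau> * real n" using elim step.prems by (simp add: field_simps)
      have "b * (real N - real N0) \<le> (round_mean ^^ N) (size_count (Suc k)) {}"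
        unfolding b_def
      proof (rule growth_window)
        show "2 \<le> Suc k" "Suc k \<le> K" using step by auto
        show "real (l div 2) \<le> \<theta> ^ (l div 2) / 2 * real n"
          using elim \<theta> by (simp add: field_simps)
        show "2 * real K * real l \<le> real n" using elim by simp
        show "N0 \<le> N" using N N0 n\<tau> by linarith
        fix M assume M: "N0 \<le> M" "4 * M \<le> n"
        then have "\<tau> / 2 * real n \<le> real M" using N0 by linarith
        then show "4 * \<theta> * real n \<le> (round_mean ^^ M) (size_count (Suc k - 1)) {}"
          using elim M by (simp add: \<theta>_def)
      qed (use \<theta> N in auto)
      moreover have "b * (\<tau> / 4 * real n) \<le> b * (real N - real N0)"
        using b N N0 n\<tau> by (intro mult_left_mono) auto
      ultimately have "b * (\<tau> / 4 * real n) \<le> (round_mean ^^ N) (size_count (Suc k)) {}"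
        by (rule order_trans[rotated])
      then show ?thesis by (simp only: mult.assoc)
    qed
    then show ?case by blast
  qed
  then show ?case using b step.prems by (intro exI[of _ "b * (\<tau> / 4)"]) simp
qed

section \<open>The expected connection time\<close>

context rule_process
begin

lemma potential_nonneg: "0 \<le> potential E"
  by (simp add: potential_def)

lemma potential_le_1: "potential E \<le> 1"
proof -
  have "potential E \<le> 1 * 1"
    unfolding potential_def using weight_nonneg by (intro mult_mono) auto
  then show ?thesis by simp
qed

text \<open>If \<open>n > K\<close>, the only component of a connected graph is large.\<close>

lemma potential_connected:
  assumes "connected_graph {1..n} E" "K < n"
  shows "potential E = 0"
proof -
  have "in_size degenerate_sizes E = {}"
    using assms(2) component_connected[OF assms(1)]
    by (auto simp: vertices_in_def degenerate_sizes_def)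
  then show ?thesis by (simp add: potential_def)
qed

text \<open>From the bounds \<open>d + 1 \<le> 2 * n\<close> and \<open>Z \<le> n\<close>; this turns a lower bound for the first moment of a
  size count into one for the mean potential.\<close>

lemma potential_ge_size_count:
  assumes "k \<in> degenerate_sizes"
  shows "exp (- weight) / (2 * real n) * size_count k E \<le> potential E"
proof -
  let ?d = "real (card (in_size degenerate_sizes E))"
  have n0: "0 < real n" using n_ge_1 by simp
  have "size_count k E \<le> ?d"
    using assms by (intro of_nat_mono card_mono) (auto simp: vertices_in_def)
  moreover have "?d + 1 \<le> 2 * real n"
    using card_in_size_le[of degenerate_sizes E] n_ge_1 by linarith
  ultimately have "size_count k E / (2 * real n) \<le> ?d / (?d + 1)"
    by (intro frac_le) auto
  moreover have "exp (- weight) \<le> exp (- weight * real (card (graph_components {1..n} E)) / real n)"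
  proof -
    have "card (graph_components {1..n} E) \<le> n"
      using card_image_le[of "{1..n}" "comp_of E"] by (simp add: graph_components_def)
    then have "weight * (real (card (graph_components {1..n} E)) / real n) \<le> weight * 1"
      using n0 by (intro mult_left_mono weight_nonneg) simp
    then show ?thesis by simp
  qed
  ultimately have "size_count k E / (2 * real n) * exp (- weight) \<le> potential E"
    unfolding potential_def by (intro mult_mono) auto
  then show ?thesis by (simp add: mult.commute)
qed

lemma connected_later:
  assumes "connected_graph {1..n} (G K l R n v N)" "N \<le> M"
  shows "connected_graph {1..n} (G K l R n v M)"
  using assms(2)
proof (induction M rule: dec_induct)
  case (step M)
  then show ?case by (simp add: next_graph_eq connected_add_edge)
qed (fact assms(1))

text \<open>The potential is at most the indicator of being disconnected, and the connection time is larger than \<open>m\<close> if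
  the graph is disconnected after \<open>m\<close> rounds.\<close>

lemma expected_T_con_ge:
  assumes "K < n"
  shows "ennreal (real m * (round_mean ^^ m) potential {}) \<le> expected_T_con K l R n"
proof -
  let ?f = "\<lambda>E. real m * potential E + 0 * potential E + 0"
  have "ennreal (real m * (round_mean ^^ m) potential {}) = ennreal ((round_mean ^^ m) ?f {})"
    using iterated_mean_affine[of m "real m" potential 0 potential 0 "{}"] by simp
  also have "\<dots> = (\<integral>\<^sup>+ v. ennreal (?f (run m {} v)) \<partial>process_space l n)"
    by (rule expectation_run[THEN conjunct1, symmetric]) (simp add: potential_nonneg)
  also have "\<dots> \<le> expected_T_con K l R n"
    unfolding expected_T_con_def
  proof (rule nn_integral_mono)
    fix v
    show "ennreal (?f (run m {} v)) \<le> ennreal_of_enat (T_con K l R n v)"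
    proof (cases "connected_graph {1..n} (G K l R n v m)")
      case True
      then show ?thesis using potential_connected[OF _ assms] by (simp add: G_eq_run)
    next
      case False
      have "enat m \<le> T_con K l R n v"
        unfolding T_con_def
      proof (rule Inf_greatest)
        fix x assume "x \<in> {enat N |N. connected_graph {1..n} (G K l R n v N)}"
        then obtain N where "x = enat N" "connected_graph {1..n} (G K l R n v N)" by blast
        then show "enat m \<le> x" using connected_later[of v N m] False by (cases "N \<le> m") auto
      qed
      then have "ennreal_of_enat (enat m) \<le> ennreal_of_enat (T_con K l R n v)"
        by (simp only: ennreal_of_enat_le_iff)
      then have T: "ennreal (real m) \<le> ennreal_of_enat (T_con K l R n v)"
        by (simp add: ennreal_of_nat_eq_real_of_nat)
      have "ennreal (?f (run m {} v)) \<le> ennreal (real m)"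
        using potential_le_1[of "run m {} v"] by (intro ennreal_leI) (simp add: mult_left_le)
      then show ?thesis using T by (rule order_trans)
    qed
  qed
  finally show ?thesis .
qed

text \<open>The first \<open>m0\<close> rounds build up components of the degenerate size \<open>k\<close>; in the following \<open>m\<close> rounds the potential
  declines at most linearly.\<close>

lemma mean_potential_ge:
  assumes "k \<in> degenerate_sizes" "weight \<le> real n"
    and "c * real n \<le> (round_mean ^^ m0) (size_count k) {}"
  shows "exp (- weight) * c / 2 - real m * (loss_rate / (real n)\<^sup>2) \<le> (round_mean ^^ (m0 + m)) potential {}"
proof -
  let ?q = "real m * (loss_rate / (real n)\<^sup>2)"
  have n0: "0 < real n" using n_ge_1 by simp
  have "exp (- weight) / (2 * real n) * (c * real n) - ?q
      \<le> exp (- weight) / (2 * real n) * (round_mean ^^ m0) (size_count k) {} - ?q"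
    using assms(3) by (intro diff_right_mono mult_left_mono) auto
  also have "\<dots> = (round_mean ^^ m0) (\<lambda>E. exp (- weight) / (2 * real n) * size_count k E + 0 * potential E + - ?q) {}"
    unfolding iterated_mean_affine by simp
  also have "\<dots> \<le> (round_mean ^^ m0) ((round_mean ^^ m) potential) {}"
  proof (rule iterated_mean_mono)
    fix E
    have "potential E - ?q \<le> (round_mean ^^ m) potential E"
      by (rule iterated_mean_drift) (rule potential_drift[OF assms(2)])
    then show "exp (- weight) / (2 * real n) * size_count k E + 0 * potential E + - ?q \<le> (round_mean ^^ m) potential E"
      using potential_ge_size_count[OF assms(1), of E] by simp
  qed
  finally show ?thesis using n0 by (simp add: funpow_add)
qed

end

theorem theorem3:
  fixes K l :: nat and R :: "(nat \<Rightarrow> csize) \<Rightarrow> nat"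
  assumes "K \<ge> 1" and "l \<ge> 1" and "even l"
    and "is_rule K l R"
    and "degenerate K l R"
  shows "ennreal_bigomega (expected_T_con K l R) (\<lambda>n. real n ^ 2)"
proof -
  have "ex K l R \<in> ex_k K l R ` {1..K}"
    unfolding ex_def using assms(1) by (intro Min_in) auto
  then obtain k where k: "1 \<le> k" "k \<le> K" "ex_k K l R k = 0"
    using assms(5) by (auto simp: degenerate_def)
  obtain c where c: "0 < c" and growth: "\<forall>\<^sub>F n in sequentially. \<forall>N. 1 / 8 * real n \<le> real N \<longrightarrow> 4 * N \<le> n \<longrightarrow>
      c * real n \<le> (rule_process.round_mean K l R n ^^ N) (\<lambda>E. real (card (vertices_in {1..n} {k} E))) {}"
    using linear_growth[OF assms(2-4) k(1,2), of "1 / 8"] by auto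
  define w where "w = rule_process.weight K l"
  define q where "q = rule_process.loss_rate K l"
  define p where "p = exp (- w) * c / 2"
  \<comment> \<open>After \<open>a * n\<^sup>2\<close> rounds the mean potential has dropped from \<open>p\<close> to no less than \<open>p / 2\<close>.\<close>
  define a where "a = p / (2 * (q + 1))"
  \<comment> \<open>The constants do not depend on the number of vertices; any value gives access to their properties.\<close>
  interpret rule_process K l R 1 using assms by unfold_locales auto
  have q: "0 \<le> q" unfolding q_def by (rule loss_rate_nonneg)
  have p: "0 < p" using c by (simp add: p_def)
  have a: "0 < a" using p q by (simp add: a_def)
  have "\<forall>\<^sub>F n in sequentially. w \<le> real n" "\<forall>\<^sub>F n in sequentially. real K + 1 \<le> real n"
    "\<forall>\<^sub>F n in sequentially. 2 / a \<le> real n" "\<forall>\<^sub>F n in sequentially. 8 \<le> real n"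
    by (rule eventually_compose_filterlim[OF eventually_ge_at_top filterlim_real_sequentially])+
  with growth have "\<forall>\<^sub>F n in sequentially. ennreal (a * p / 4 * \<bar>real n ^ 2\<bar>) \<le> expected_T_con K l R n"
  proof eventually_elim
    case (elim n)
    interpret P: rule_process K l R n using assms elim by unfold_locales auto
    define m where "m = nat \<lfloor>a * (real n)\<^sup>2\<rfloor>"
    have n0: "0 < real n" using elim by simp
    have an: "0 \<le> a * (real n)\<^sup>2" using a by simp
    then have m: "real m \<le> a * (real n)\<^sup>2" "a * (real n)\<^sup>2 - 1 \<le> real m"
      unfolding m_def by linarith+
    have "c * real n \<le> (P.round_mean ^^ (n div 4)) (P.size_count k) {}"
      using elim by auto
    then have mean: "p - real m * (q / (real n)\<^sup>2) \<le> (P.round_mean ^^ (n div 4 + m)) P.potential {}"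
      unfolding p_def q_def w_def
      by (intro P.mean_potential_ge) (use k elim in \<open>auto simp: P.degenerate_sizes_def w_def\<close>)
    have "real m * (q / (real n)\<^sup>2) \<le> a * (real n)\<^sup>2 * (q / (real n)\<^sup>2)"
      using m q by (intro mult_right_mono) auto
    also have "\<dots> = a * q" using n0 by simp
    also have "\<dots> \<le> a * (q + 1)" using a by simp
    also have "\<dots> = p / 2"
    proof -
      have eq: "x / (2 * y) * y = x / 2" if "0 < y" for x y :: real using that by simp
      show ?thesis using q unfolding a_def by (intro eq) simp
    qed
    finally have mean': "p / 2 \<le> (P.round_mean ^^ (n div 4 + m)) P.potential {}"
      using mean by linarith
    have "2 \<le> a * real n" using elim a by (simp add: field_simps)
    also have "\<dots> \<le> a * (real n)\<^sup>2" using elim a by (simp add: power2_eq_square)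
    finally have "a * (real n)\<^sup>2 / 2 \<le> real (n div 4 + m)" using m by simp
    then have "a * (real n)\<^sup>2 / 2 * (p / 2) \<le> real (n div 4 + m) * (P.round_mean ^^ (n div 4 + m)) P.potential {}"
      using mean' p an by (intro mult_mono) auto
    then have "ennreal (a * (real n)\<^sup>2 / 2 * (p / 2)) \<le> ennreal (real (n div 4 + m) * (P.round_mean ^^ (n div 4 + m)) P.potential {})"
      by (rule ennreal_leI)
    also have "\<dots> \<le> expected_T_con K l R n"
      by (rule P.expected_T_con_ge) (use elim in auto)
    finally show ?case by (simp add: mult_ac)
  qed
  then show ?thesis
    unfolding ennreal_bigomega_def using a p by (intro exI[of _ "a * p / 4"]) auto
qed

end
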